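(* Let $d\ge2$, let $M$ be a smooth complete Riemannian $d$-manifold with Riemannian volume measure $\nu$, and let $\Omega\subseteq M$ be a bounded domain with smooth boundary on which the (Dirichlet) Green's function exists. Let $\mu$ be a positive finite Borel measure on $M$ with $\operatorname{supp}(\mu)\subseteq\overline\Omega$ and $\mu(\Omega)>0$. Assume $\underline{\dim}_\infty(\mu)>d-2$ and $\underline{\dim}_\infty(\nu)>d-2$. Then for any $f\in L^2(\Omega,\mu)$, $$-\Delta_\mu\big(G_\mu f+h_\mu(f)\big)=f.$$ Moreover, $(G_\mu+h_\mu)\big(L^2(\Omega,\mu)\big)\subseteq\operatorname{dom}(-\Delta_\mu)$ and $G_\mu+h_\mu=(-\Delta_\mu)^{-1}$.
   Context: $(M,g)$ is an oriented complete smooth Riemannian $d$-manifold, $\Delta$ its Laplace–Beltrami operator ($\Delta=\operatorname{div}\nabla$). A domain is an open connected set. $W_0^{1,2}(\Omega)$ is the closure of $C_c^\infty(\Omega)$ in $W^{1,2}(\Omega)$. The lower $L^\infty$-dimension of a Borel measure $\mu$ is $\underline{\dim}_\infty(\mu):=\liminf_{\delta\to0^+}\frac{\ln(\sup_{x\in\operatorname{supp}(\mu)}\mu(B_\delta^M(x)))}{\ln\delta}$, where $B_\delta^M(x)$ is the ball of radius $\delta$ about $x$. The (Dirichlet) Green's function $G_y(x)$ on $\Omega$ satisfies $-\Delta G_y=\delta_y$ in the distributional sense for every $y\in\Omega$, is positive and symmetric, and vanishes on $\partial\Omega$. The Green operator is $(G_\mu f)(x)=\int_\Omega G_y(x)f(y)\,d\mu(y)$;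 it is a bounded operator on $L^2(\Omega,\mu)$. Kreĭn–Feller operator: since $\underline{\dim}_\infty(\mu)>d-2$, the inclusion $C_c^\infty(\Omega)\to L^2(\Omega,\mu)$ extends to a bounded map $\iota:W_0^{1,2}(\Omega)\to L^2(\Omega,\mu)$; $\iota(u)$ is the $L^2(\Omega,\mu)$-representative of $u$ and is again denoted $u$. Put $\mathcal{E}(u,v)=\int_\Omega\langle\nabla u,\nabla v\rangle\,d\nu$ with $\operatorname{dom}(\mathcal{E})=\{u\in W_0^{1,2}(\Omega):\mathcal{E}(u,w)=0\ \text{for all}\ w\in\ker\iota\}$, which embeds injectively and densely in $L^2(\Omega,\mu)$. Then $\mathcal{E}$ is a closed form on $L^2(\Omega,\mu)$ and $-\Delta_\mu$ is the associated nonnegative self-adjoint operator. Equivalently, $u\in\operatorname{dom}(\Delta_\mu)$ and $-\Delta_\mu u=f$ iff $u\in W_0^{1,2}(\Omega)$, $f\in L^2(\Omega,\mu)$ and $\int_\Omega\langle\nabla u,\nabla v\rangle\,d\nu=\int_\Omega fv\,d\mu$ for all $v\in C_c^\infty(\Omega)$. The harmonic operator $h_\mu$: for $f\in L^2(\Omega,\mu)$ let $u_f\in W_0^{1,2}(\Omega)$ be the unique element of $W_0^{1,2}(\Omega)$ with $\int_\Omega u_f\,\Delta v\,d\nu=-\int_\Omega vf\,d\mu$ for all $v\in C_c^\infty(\Omega)$. Then $h_\mu(f):=u_f-G_\mu f$, which is a smooth harmonic function on $\Omega$ belonging to $L^2(\Omega,\mu)$. *)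

theory Defs
  imports "HOL-Analysis.Analysis"
begin

text \<open>
  Conventions. A manifold is the whole of a Hausdorff second countable type \<open>'m\<close> together with
  an oriented smooth atlas \<open>A\<close>; its dimension is \<open>CARD('n)\<close>. Tensor fields are families of
  component functions indexed by the charts of \<open>A\<close>, evaluated at points of \<open>'m\<close> and related by the
  usual transformation laws; values at points outside the domain of the chart are irrelevant.
  Quantities that do not depend on the chart are evaluated in an arbitrary chart around the point.
\<close>

section \<open>Smooth functions on open subsets of Euclidean space\<close>

definition partial :: "'n \<Rightarrow> (real^'n::finite \<Rightarrow> real) \<Rightarrow> real^'n \<Rightarrow> real" where
  "partial i f x = frechet_derivative f (at x) (axis i 1)"

primrec Ck_on :: "nat \<Rightarrow> (real^'n::finite) set \<Rightarrow> (real^'n \<Rightarrow> real) \<Rightarrow> bool" where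
  "Ck_on 0 S f \<longleftrightarrow> continuous_on S f"
| "Ck_on (Suc k) S f \<longleftrightarrow> f differentiable_on S \<and> (\<forall>i. Ck_on k S (partial i f))"

text \<open>Only used for open \<open>S\<close>.\<close>

definition Cinf_on :: "(real^'n::finite) set \<Rightarrow> (real^'n \<Rightarrow> real) \<Rightarrow> bool" where
  "Cinf_on S f \<longleftrightarrow> (\<forall>k. Ck_on k S f)"

section \<open>Oriented smooth manifolds\<close>

type_synonym ('m, 'n) chart = "'m set \<times> ('m \<Rightarrow> real^'n)"

abbreviation cdom :: "('m, 'n) chart \<Rightarrow> 'm set" where "cdom c \<equiv> fst c"
abbreviation cmap :: "('m, 'n) chart \<Rightarrow> 'm \<Rightarrow> real^'n" where "cmap c \<equiv> snd c"

definition cinv :: "('m, 'n) chart \<Rightarrow> real^'n \<Rightarrow> 'm" where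
  "cinv c = inv_into (cdom c) (cmap c)"

definition is_chart :: "('m::topological_space, 'n::finite) chart \<Rightarrow> bool" where
  "is_chart c \<longleftrightarrow> open (cdom c) \<and> open (cmap c ` cdom c)
     \<and> homeomorphism (cdom c) (cmap c ` cdom c) (cmap c) (cinv c)"

definition transition :: "('m, 'n) chart \<Rightarrow> ('m, 'n) chart \<Rightarrow> real^'n \<Rightarrow> real^'n" where
  "transition c c' = cmap c' \<circ> cinv c"

definition transition_jac ::
    "('m, 'n::finite) chart \<Rightarrow> ('m, 'n) chart \<Rightarrow> 'm \<Rightarrow> real^'n^'n" where
  "transition_jac c c' p = jacobian (transition c c') (at (cmap c p))"

definition oriented_smooth_atlas ::
    "('m::{second_countable_topology, t2_space}, 'n::finite) chart set \<Rightarrow> bool" where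
  "oriented_smooth_atlas A \<longleftrightarrow>
     (\<forall>c\<in>A. is_chart c) \<and> (\<Union>c\<in>A. cdom c) = UNIV
     \<and> (\<forall>c\<in>A. \<forall>c'\<in>A.
          (\<forall>i. Cinf_on (cmap c ` (cdom c \<inter> cdom c')) (\<lambda>x. transition c c' x $ i))
          \<and> (\<forall>p\<in>cdom c \<inter> cdom c'. det (transition_jac c c' p) > 0))"

definition chart_at :: "('m, 'n) chart set \<Rightarrow> 'm \<Rightarrow> ('m, 'n) chart" where
  "chart_at A p = (SOME c. c \<in> A \<and> p \<in> cdom c)"

definition smooth_fun ::
    "('m, 'n::finite) chart set \<Rightarrow> 'm set \<Rightarrow> ('m \<Rightarrow> real) \<Rightarrow> bool" where
  "smooth_fun A S u \<longleftrightarrow> (\<forall>c\<in>A. Cinf_on (cmap c ` (cdom c \<inter> S)) (u \<circ> cinv c))"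

definition coord_partial ::
    "('m, 'n::finite) chart \<Rightarrow> 'n \<Rightarrow> ('m \<Rightarrow> real) \<Rightarrow> 'm \<Rightarrow> real" where
  "coord_partial c i u p = partial i (u \<circ> cinv c) (cmap c p)"

text \<open>Elements of \<open>C\<^sub>c\<^sup>\<infinity>(\<Omega>)\<close> are represented by their extension by zero to the whole manifold.\<close>

definition test_fun ::
    "('m::topological_space, 'n::finite) chart set \<Rightarrow> 'm set \<Rightarrow> ('m \<Rightarrow> real) \<Rightarrow> bool" where
  "test_fun A \<Omega> v \<longleftrightarrow> smooth_fun A UNIV v
     \<and> compact (closure {p. v p \<noteq> 0}) \<and> closure {p. v p \<noteq> 0} \<subseteq> \<Omega>"

type_synonym ('m, 'n) vfield = "('m, 'n) chart \<Rightarrow> 'm \<Rightarrow> real^'n"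

definition vector_field :: "('m, 'n::finite) chart set \<Rightarrow> ('m, 'n) vfield \<Rightarrow> bool" where
  "vector_field A V \<longleftrightarrow> (\<forall>c\<in>A. \<forall>c'\<in>A. \<forall>p\<in>cdom c \<inter> cdom c'. V c' p = transition_jac c c' p *v V c p)"

definition test_vector_field ::
    "('m::topological_space, 'n::finite) chart set \<Rightarrow> 'm set \<Rightarrow> ('m, 'n) vfield \<Rightarrow> bool" where
  "test_vector_field A \<Omega> X \<longleftrightarrow> vector_field A X
     \<and> (\<forall>c\<in>A. \<forall>i. Cinf_on (cmap c ` cdom c) (\<lambda>x. X c (cinv c x) $ i))
     \<and> (let S = closure {p. \<exists>c\<in>A. p \<in> cdom c \<and> X c p \<noteq> 0} in compact S \<and> S \<subseteq> \<Omega>)"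

section \<open>Riemannian metrics\<close>

text \<open>\<open>g c p\<close> is the Gram matrix, at the point \<open>p\<close>, of the coordinate vector fields of the chart \<open>c\<close>.\<close>

type_synonym ('m, 'n) metric = "('m, 'n) chart \<Rightarrow> 'm \<Rightarrow> real^'n^'n"

definition riemannian_metric ::
    "('m, 'n::finite) chart set \<Rightarrow> ('m, 'n) metric \<Rightarrow> bool" where
  "riemannian_metric A g \<longleftrightarrow>
     (\<forall>c\<in>A. \<forall>i j. Cinf_on (cmap c ` cdom c) (\<lambda>x. g c (cinv c x) $ i $ j))
     \<and> (\<forall>c\<in>A. \<forall>p\<in>cdom c. transpose (g c p) = g c p \<and> (\<forall>v. v \<noteq> 0 \<longrightarrow> v \<bullet> (g c p *v v) > 0))
     \<and> (\<forall>c\<in>A. \<forall>c'\<in>A. \<forall>p\<in>cdom c \<inter> cdom c'.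
          g c p = transpose (transition_jac c c' p) ** g c' p ** transition_jac c c' p)"

definition rinner ::
    "('m, 'n::finite) chart set \<Rightarrow> ('m, 'n) metric \<Rightarrow> ('m, 'n) vfield \<Rightarrow> ('m, 'n) vfield \<Rightarrow> 'm \<Rightarrow> real" where
  "rinner A g V W p = (let c = chart_at A p in V c p \<bullet> (g c p *v W c p))"

definition grad :: "('m, 'n::finite) metric \<Rightarrow> ('m \<Rightarrow> real) \<Rightarrow> ('m, 'n) vfield" where
  "grad g u c p = matrix_inv (g c p) *v (\<chi> i. coord_partial c i u p)"

definition vol_density :: "('m, 'n::finite) metric \<Rightarrow> ('m, 'n) chart \<Rightarrow> 'm \<Rightarrow> real" where
  "vol_density g c p = sqrt (det (g c p))"

definition divergence ::
    "('m, 'n::finite) chart set \<Rightarrow> ('m, 'n) metric \<Rightarrow> ('m, 'n) vfield \<Rightarrow> 'm \<Rightarrow> real" where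
  "divergence A g V p = (let c = chart_at A p in
     (\<Sum>i\<in>UNIV. coord_partial c i (\<lambda>q. vol_density g c q * V c q $ i) p) / vol_density g c p)"

definition laplacian ::
    "('m, 'n::finite) chart set \<Rightarrow> ('m, 'n) metric \<Rightarrow> ('m \<Rightarrow> real) \<Rightarrow> 'm \<Rightarrow> real" where
  "laplacian A g u = divergence A g (grad g u)"

definition riemannian_volume ::
    "('m::topological_space, 'n::finite) chart set \<Rightarrow> ('m, 'n) metric \<Rightarrow> 'm measure \<Rightarrow> bool" where
  "riemannian_volume A g \<nu> \<longleftrightarrow> sets \<nu> = sets borel
     \<and> (\<forall>c\<in>A. \<forall>B\<in>sets borel. B \<subseteq> cdom c \<longrightarrow>
          emeasure \<nu> B = (\<integral>\<^sup>+x\<in>cmap c ` B. ennreal (vol_density g c (cinv c x)) \<partial>lborel))"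

definition piecewise_C1_curve ::
    "('m::topological_space, 'n::finite) chart set \<Rightarrow> (real \<Rightarrow> 'm) \<Rightarrow> bool" where
  "piecewise_C1_curve A \<gamma> \<longleftrightarrow> continuous_on {0..1} \<gamma>
     \<and> (\<exists>S. finite S \<and> (\<forall>t\<in>{0<..<1} - S. \<forall>c\<in>A. \<gamma> t \<in> cdom c \<longrightarrow>
          (\<exists>e>0. (cmap c \<circ> \<gamma>) C1_differentiable_on {t - e<..<t + e})))"

definition curve_length ::
    "('m, 'n::finite) chart set \<Rightarrow> ('m, 'n) metric \<Rightarrow> (real \<Rightarrow> 'm) \<Rightarrow> ennreal" where
  "curve_length A g \<gamma> = (\<integral>\<^sup>+t\<in>{0..1}.
     (let c = chart_at A (\<gamma> t); v = vector_derivative (cmap c \<circ> \<gamma>) (at t)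
      in ennreal (sqrt (v \<bullet> (g c (\<gamma> t) *v v)))) \<partial>lborel)"

text \<open>The distance is \<open>\<infinity>\<close> between points of different components, so that connectedness of the
  manifold need not be required.\<close>

definition rdist ::
    "('m::topological_space, 'n::finite) chart set \<Rightarrow> ('m, 'n) metric \<Rightarrow> 'm \<Rightarrow> 'm \<Rightarrow> ennreal" where
  "rdist A g p q = (INF \<gamma>\<in>{\<gamma>. piecewise_C1_curve A \<gamma> \<and> \<gamma> 0 = p \<and> \<gamma> 1 = q}. curve_length A g \<gamma>)"

definition rball ::
    "('m::topological_space, 'n::finite) chart set \<Rightarrow> ('m, 'n) metric \<Rightarrow> 'm \<Rightarrow> real \<Rightarrow> 'm set" where
  "rball A g x r = {y. rdist A g x y < ennreal r}"

definition rcomplete ::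
    "('m::topological_space, 'n::finite) chart set \<Rightarrow> ('m, 'n) metric \<Rightarrow> bool" where
  "rcomplete A g \<longleftrightarrow> (\<forall>s :: nat \<Rightarrow> 'm.
     (\<forall>e>0. \<exists>N. \<forall>m\<ge>N. \<forall>n\<ge>N. rdist A g (s m) (s n) < ennreal e)
     \<longrightarrow> (\<exists>p. (\<lambda>n. rdist A g (s n) p) \<longlonglongrightarrow> 0))"

definition rbounded ::
    "('m::topological_space, 'n::finite) chart set \<Rightarrow> ('m, 'n) metric \<Rightarrow> 'm set \<Rightarrow> bool" where
  "rbounded A g S \<longleftrightarrow> (\<exists>p r. S \<subseteq> rball A g p r)"

text \<open>Near each boundary point, \<open>\<Omega>\<close> is the sublevel set of a smooth function without critical points.\<close>

definition smooth_boundary ::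
    "('m::topological_space, 'n::finite) chart set \<Rightarrow> 'm set \<Rightarrow> bool" where
  "smooth_boundary A \<Omega> \<longleftrightarrow> (\<forall>p\<in>frontier \<Omega>. \<exists>c\<in>A. \<exists>W \<rho>.
     open W \<and> p \<in> W \<and> W \<subseteq> cdom c \<and> smooth_fun A W \<rho>
     \<and> (\<forall>q\<in>W. \<exists>i. coord_partial c i \<rho> q \<noteq> 0) \<and> \<Omega> \<inter> W = {q \<in> W. \<rho> q < 0})"

section \<open>Lower \<open>L\<^sup>\<infinity>\<close>-dimension\<close>

definition msupp :: "'m::topological_space measure \<Rightarrow> 'm set" where
  "msupp \<mu> = {x. \<forall>U. open U \<longrightarrow> x \<in> U \<longrightarrow> emeasure \<mu> U > 0}"

definition eln :: "ennreal \<Rightarrow> ereal" where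
  "eln x = (if x = 0 then -\<infinity> else if x = \<infinity> then \<infinity> else ereal (ln (enn2real x)))"

definition lower_Linf_dim ::
    "('m::topological_space, 'n::finite) chart set \<Rightarrow> ('m, 'n) metric \<Rightarrow> 'm measure \<Rightarrow> ereal" where
  "lower_Linf_dim A g \<mu> = Liminf (at_right 0)
     (\<lambda>\<delta>::real. eln (SUP x\<in>msupp \<mu>. emeasure \<mu> (rball A g x \<delta>)) / ereal (ln \<delta>))"

section \<open>\<open>L\<^sup>2\<close> and Sobolev spaces\<close>

text \<open>Elements of \<open>L\<^sup>2\<close> are represented by functions; equality in \<open>L\<^sup>2\<close> is equality almost everywhere.\<close>

definition L2 :: "'m measure \<Rightarrow> ('m \<Rightarrow> real) set" where
  "L2 N = {f. f \<in> borel_measurable N \<and> integrable N (\<lambda>x. (f x)\<^sup>2)}"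

definition dirichlet_form ::
    "('m, 'n::finite) chart set \<Rightarrow> ('m, 'n) metric \<Rightarrow> 'm measure \<Rightarrow> 'm set
      \<Rightarrow> ('m, 'n) vfield \<Rightarrow> ('m, 'n) vfield \<Rightarrow> real" where
  "dirichlet_form A g \<nu> \<Omega> V W = (\<integral>x. rinner A g V W x \<partial>restrict_space \<nu> \<Omega>)"

text \<open>\<open>W12 A g \<nu> \<Omega> u U\<close>: \<open>u\<close> belongs to \<open>W\<^sup>1\<^sup>,\<^sup>2(\<Omega>)\<close> and \<open>U\<close> is (a representative of) its weak gradient.\<close>

definition W12 ::
    "('m::topological_space, 'n::finite) chart set \<Rightarrow> ('m, 'n) metric \<Rightarrow> 'm measure \<Rightarrow> 'm set
      \<Rightarrow> ('m \<Rightarrow> real) \<Rightarrow> ('m, 'n) vfield \<Rightarrow> bool" where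
  "W12 A g \<nu> \<Omega> u U \<longleftrightarrow>
     u \<in> L2 (restrict_space \<nu> \<Omega>) \<and> vector_field A U
     \<and> (\<forall>c\<in>A. U c \<in> borel_measurable (restrict_space \<nu> (\<Omega> \<inter> cdom c)))
     \<and> integrable (restrict_space \<nu> \<Omega>) (rinner A g U U)
     \<and> (\<forall>X. test_vector_field A \<Omega> X \<longrightarrow>
          (\<integral>x. rinner A g U X x \<partial>restrict_space \<nu> \<Omega>)
            = - (\<integral>x. u x * divergence A g X x \<partial>restrict_space \<nu> \<Omega>))"

definition sobolev_sq ::
    "('m, 'n::finite) chart set \<Rightarrow> ('m, 'n) metric \<Rightarrow> 'm measure \<Rightarrow> 'm set
      \<Rightarrow> ('m \<Rightarrow> real) \<Rightarrow> ('m, 'n) vfield \<Rightarrow> real" where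
  "sobolev_sq A g \<nu> \<Omega> u U = (\<integral>x. (u x)\<^sup>2 \<partial>restrict_space \<nu> \<Omega>) + dirichlet_form A g \<nu> \<Omega> U U"

definition W12_tendsto ::
    "('m, 'n::finite) chart set \<Rightarrow> ('m, 'n) metric \<Rightarrow> 'm measure \<Rightarrow> 'm set
      \<Rightarrow> (nat \<Rightarrow> 'm \<Rightarrow> real) \<Rightarrow> ('m \<Rightarrow> real) \<Rightarrow> ('m, 'n) vfield \<Rightarrow> bool" where
  "W12_tendsto A g \<nu> \<Omega> \<phi> u U \<longleftrightarrow>
     (\<lambda>k. sobolev_sq A g \<nu> \<Omega> (\<lambda>x. \<phi> k x - u x) (\<lambda>c p. grad g (\<phi> k) c p - U c p)) \<longlonglongrightarrow> 0"

definition W012 ::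
    "('m::topological_space, 'n::finite) chart set \<Rightarrow> ('m, 'n) metric \<Rightarrow> 'm measure \<Rightarrow> 'm set
      \<Rightarrow> ('m \<Rightarrow> real) \<Rightarrow> ('m, 'n) vfield \<Rightarrow> bool" where
  "W012 A g \<nu> \<Omega> u U \<longleftrightarrow> W12 A g \<nu> \<Omega> u U
     \<and> (\<exists>\<phi>. (\<forall>k. test_fun A \<Omega> (\<phi> k)) \<and> W12_tendsto A g \<nu> \<Omega> \<phi> u U)"

text \<open>
  The graph of \<open>\<iota>\<close>, i.e. the closure in \<open>W\<^sub>0\<^sup>1\<^sup>,\<^sup>2(\<Omega>) \<times> L\<^sup>2(\<Omega>, \<mu>)\<close> of the graph of the inclusion
  of \<open>C\<^sub>c\<^sup>\<infinity>(\<Omega>)\<close>: \<open>w\<close> is the \<open>L\<^sup>2(\<Omega>, \<mu>)\<close>-representative of the element \<open>u\<close> (with gradient \<open>U\<close>). When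
  the inclusion is bounded this is exactly the graph of its continuous extension.
\<close>

definition iota ::
    "('m::topological_space, 'n::finite) chart set \<Rightarrow> ('m, 'n) metric \<Rightarrow> 'm measure \<Rightarrow> 'm set
      \<Rightarrow> 'm measure \<Rightarrow> ('m \<Rightarrow> real) \<Rightarrow> ('m, 'n) vfield \<Rightarrow> ('m \<Rightarrow> real) \<Rightarrow> bool" where
  "iota A g \<nu> \<Omega> \<mu> u U w \<longleftrightarrow> W012 A g \<nu> \<Omega> u U \<and> w \<in> L2 (restrict_space \<mu> \<Omega>)
     \<and> (\<exists>\<phi>. (\<forall>k. test_fun A \<Omega> (\<phi> k)) \<and> W12_tendsto A g \<nu> \<Omega> \<phi> u U
            \<and> (\<lambda>k. \<integral>x. (\<phi> k x - w x)\<^sup>2 \<partial>restrict_space \<mu> \<Omega>) \<longlonglongrightarrow> 0)"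

section \<open>The Krein--Feller operator\<close>

definition form_dom ::
    "('m::topological_space, 'n::finite) chart set \<Rightarrow> ('m, 'n) metric \<Rightarrow> 'm measure \<Rightarrow> 'm set
      \<Rightarrow> 'm measure \<Rightarrow> ('m \<Rightarrow> real) \<Rightarrow> ('m, 'n) vfield \<Rightarrow> bool" where
  "form_dom A g \<nu> \<Omega> \<mu> u U \<longleftrightarrow> W012 A g \<nu> \<Omega> u U
     \<and> (\<forall>z Z. iota A g \<nu> \<Omega> \<mu> z Z (\<lambda>_. 0) \<longrightarrow> dirichlet_form A g \<nu> \<Omega> U Z = 0)"

text \<open>
  The graph of the operator \<open>-\<Delta>\<^sub>\<mu>\<close> associated with the form on \<open>L\<^sup>2(\<Omega>, \<mu>)\<close>: the pair \<open>(u, f)\<close> belongs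
  to it iff \<open>u\<close> lies in the domain of the form and \<open>\<E>(u, v) = \<langle>f, v\<rangle>\<close> for all \<open>v\<close> in that domain.
\<close>

definition neg_krein_feller ::
    "('m::topological_space, 'n::finite) chart set \<Rightarrow> ('m, 'n) metric \<Rightarrow> 'm measure \<Rightarrow> 'm set
      \<Rightarrow> 'm measure \<Rightarrow> (('m \<Rightarrow> real) \<times> ('m \<Rightarrow> real)) set" where
  "neg_krein_feller A g \<nu> \<Omega> \<mu> = {(u, f). f \<in> L2 (restrict_space \<mu> \<Omega>)
     \<and> (\<exists>u\<^sub>0 U w. form_dom A g \<nu> \<Omega> \<mu> u\<^sub>0 U \<and> iota A g \<nu> \<Omega> \<mu> u\<^sub>0 U w
          \<and> (AE x in restrict_space \<mu> \<Omega>. u x = w x)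
          \<and> (\<forall>v\<^sub>0 V v. form_dom A g \<nu> \<Omega> \<mu> v\<^sub>0 V \<longrightarrow> iota A g \<nu> \<Omega> \<mu> v\<^sub>0 V v \<longrightarrow>
               dirichlet_form A g \<nu> \<Omega> U V = (\<integral>x. f x * v x \<partial>restrict_space \<mu> \<Omega>)))}"

section \<open>Green operator and harmonic operator\<close>

text \<open>
  \<open>G y x\<close> stands for \<open>G\<^sub>y(x)\<close>. The pole \<open>x = y\<close>, where \<open>G\<^sub>y\<close> is infinite, is exempt from the
  conditions, so the real number \<open>G y y\<close> carries no information. Continuity off the pole and up to
  the boundary selects the pointwise representative of the distributional solution; this is
  needed to integrate against a measure \<open>\<mu>\<close> that may be singular.
\<close>

definition dirichlet_green ::
    "('m::topological_space, 'n::finite) chart set \<Rightarrow> ('m, 'n) metric \<Rightarrow> 'm measure \<Rightarrow> 'm set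
      \<Rightarrow> ('m \<Rightarrow> 'm \<Rightarrow> real) \<Rightarrow> bool" where
  "dirichlet_green A g \<nu> \<Omega> G \<longleftrightarrow> (\<forall>y\<in>\<Omega>.
     (\<forall>K. compact K \<longrightarrow> K \<subseteq> \<Omega> \<longrightarrow> set_integrable \<nu> K (G y))
     \<and> (\<forall>v. test_fun A \<Omega> v \<longrightarrow> (\<integral>x. G y x * laplacian A g v x \<partial>restrict_space \<nu> \<Omega>) = - v y)
     \<and> (\<forall>x\<in>\<Omega>. x \<noteq> y \<longrightarrow> G y x > 0)
     \<and> (\<forall>x\<in>\<Omega>. G y x = G x y)
     \<and> continuous_on (closure \<Omega> - {y}) (G y)
     \<and> (\<forall>x\<in>frontier \<Omega>. G y x = 0))"

definition green_op ::
    "'m set \<Rightarrow> 'm measure \<Rightarrow> ('m \<Rightarrow> 'm \<Rightarrow> real) \<Rightarrow> ('m \<Rightarrow> real) \<Rightarrow> 'm \<Rightarrow> real" where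
  "green_op \<Omega> \<mu> G f x = (\<integral>y. G y x * f y \<partial>restrict_space \<mu> \<Omega>)"

definition poisson_solution ::
    "('m::topological_space, 'n::finite) chart set \<Rightarrow> ('m, 'n) metric \<Rightarrow> 'm measure \<Rightarrow> 'm set
      \<Rightarrow> 'm measure \<Rightarrow> ('m \<Rightarrow> real) \<Rightarrow> ('m \<Rightarrow> real) \<Rightarrow> ('m, 'n) vfield \<Rightarrow> bool" where
  "poisson_solution A g \<nu> \<Omega> \<mu> f u U \<longleftrightarrow> W012 A g \<nu> \<Omega> u U
     \<and> (\<forall>v. test_fun A \<Omega> v \<longrightarrow>
          (\<integral>x. u x * laplacian A g v x \<partial>restrict_space \<nu> \<Omega>)
            = - (\<integral>x. v x * f x \<partial>restrict_space \<mu> \<Omega>))"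

text \<open>
  \<open>h\<close> is the harmonic operator: \<open>h f = u\<^sub>f - G\<^sub>\<mu> f\<close> in \<open>L\<^sup>2(\<Omega>, \<mu>)\<close>, where \<open>u\<^sub>f\<close> is the unique solution of
  the Poisson problem and is identified with its \<open>L\<^sup>2(\<Omega>, \<mu>)\<close>-representative \<open>w = \<iota>(u\<^sub>f)\<close>.
\<close>

definition harmonic_operator ::
    "('m::topological_space, 'n::finite) chart set \<Rightarrow> ('m, 'n) metric \<Rightarrow> 'm measure \<Rightarrow> 'm set
      \<Rightarrow> 'm measure \<Rightarrow> ('m \<Rightarrow> 'm \<Rightarrow> real) \<Rightarrow> (('m \<Rightarrow> real) \<Rightarrow> 'm \<Rightarrow> real) \<Rightarrow> bool" where
  "harmonic_operator A g \<nu> \<Omega> \<mu> G h \<longleftrightarrow> (\<forall>f\<in>L2 (restrict_space \<mu> \<Omega>).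
     \<exists>u U w. poisson_solution A g \<nu> \<Omega> \<mu> f u U
       \<and> (\<forall>u' U'. poisson_solution A g \<nu> \<Omega> \<mu> f u' U' \<longrightarrow> (AE x in restrict_space \<nu> \<Omega>. u' x = u x))
       \<and> iota A g \<nu> \<Omega> \<mu> u U w
       \<and> (AE x in restrict_space \<mu> \<Omega>. h f x = w x - green_op \<Omega> \<mu> G f x))"

end

theory Submission
  imports Defs
begin

text \<open>
  Testing the weak gradient of the Poisson solution \<open>u\<^sub>f\<close> against the vector field \<open>\<nabla>\<phi>\<close> turns the
  distributional equation into \<open>\<integral>\<langle>\<nabla>u\<^sub>f, \<nabla>\<phi>\<rangle> d\<nu> = \<integral>f \<phi> d\<mu>\<close> for test functions \<open>\<phi>\<close>. Both sides pass to the
  limit along a sequence approximating an element of the graph of \<open>\<iota>\<close>, so the identity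
  \<open>\<E>(u\<^sub>f, v) = \<langle>f, \<iota>(v)\<rangle>\<close> holds on all of \<open>W\<^sub>0\<^sup>1\<^sup>,\<^sup>2(\<Omega>)\<close>. For \<open>\<iota>(v) = 0\<close> it puts \<open>u\<^sub>f\<close> into the domain of the
  form, and in general it says that \<open>-\<Delta>\<^sub>\<mu> u\<^sub>f = f\<close>. Injectivity of \<open>-\<Delta>\<^sub>\<mu>\<close> follows by duality: if \<open>w\<close> and
  \<open>w'\<close> have the same image \<open>f\<close>, pairing both with the solution for the right-hand side \<open>w - w'\<close> and using
  the symmetry of the form gives \<open>\<parallel>w - w'\<parallel>\<^sup>2 = 0\<close>.
\<close>

section \<open>Calculus of smooth functions\<close>

text \<open>On an open set a derivative at a point depends only on values inside the set, so
  equality on \<open>S\<close> is inherited by every partial derivative and the induction proceeds.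
  This allows partial derivatives to be replaced by explicit formulas in the closure lemmas
  below.\<close>

lemma Ck_on_cong:
  assumes "open S" "\<And>x. x \<in> S \<Longrightarrow> f x = g x" "Ck_on k S f"
  shows "Ck_on k S g"
  using assms
proof (induction k arbitrary: f g)
  case 0
  then show ?case by (metis Ck_on.simps(1) continuous_on_cong)
next
  case (Suc k)
  have *: "(f has_derivative D) (at x) \<longleftrightarrow> (g has_derivative D) (at x)" if "x \<in> S" for x D
    using has_derivative_transform_within_open[of f D x UNIV S g]
      has_derivative_transform_within_open[of g D x UNIV S f] Suc.prems that by metis
  \<comment> \<open>\<open>frechet_derivative\<close> is a choice among the maps satisfying
    \<open>has_derivative\<close>; the predicates for \<open>f\<close> and \<open>g\<close> coincide
    at \<open>x\<close>, hence so do the choices.\<close>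
  have "partial i f x = partial i g x" if "x \<in> S" for i x
    using *[OF that] by (simp add: partial_def frechet_derivative_def)
  then have "Ck_on k S (partial i g)" for i
    using Suc.IH[of "partial i f" "partial i g"] Suc.prems by auto
  moreover have "g differentiable_on S"
    using Suc.prems * by (simp add: differentiable_on_eq_differentiable_at differentiable_def)
  ultimately show ?case by simp
qed

lemma Ck_on_SucD: "Ck_on (Suc k) S f \<Longrightarrow> Ck_on k S f"
  by (induction k arbitrary: f) (auto simp: differentiable_imp_continuous_on)

lemma partial_eq: "(f has_derivative D) (at x) \<Longrightarrow> partial i f x = D (axis i 1)"
  by (simp add: partial_def frechet_derivative_at[symmetric])

lemma Ck_on_const: "Ck_on k S (\<lambda>_. c)"
proof (induction k arbitrary: c)
  case (Suc k)
  have "partial i (\<lambda>_. c) = (\<lambda>_. 0)" for i :: 'a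
    by (auto simp: partial_eq[OF has_derivative_const])
  then show ?case using Suc by simp
qed simp

lemma Ck_on_add:
  assumes "open S" "Ck_on k S f" "Ck_on k S g"
  shows "Ck_on k S (\<lambda>x. f x + g x)"
  using assms(2,3)
proof (induction k arbitrary: f g)
  case (Suc k)
  have d: "(f has_derivative frechet_derivative f (at x)) (at x)"
    "(g has_derivative frechet_derivative g (at x)) (at x)" if "x \<in> S" for x
    using Suc.prems assms(1) that
    by (auto simp: differentiable_on_eq_differentiable_at frechet_derivative_works)
  have "partial i f x + partial i g x = partial i (\<lambda>x. f x + g x) x" if "x \<in> S" for i x
    using partial_eq[OF has_derivative_add[OF d[OF that]], of i] by (simp add: partial_def)
  moreover have "Ck_on k S (\<lambda>x. partial i f x + partial i g x)" for i
    using Suc by simp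
  ultimately have "Ck_on k S (partial i (\<lambda>x. f x + g x))" for i
    using Ck_on_cong[OF assms(1), of "\<lambda>x. partial i f x + partial i g x"] by auto
  then show ?case using Suc.prems by (auto intro: differentiable_on_add)
qed (auto intro: continuous_on_add)

text \<open>Induction by the product rule. Its summands still contain the undifferentiated factors,
  which are lowered to order \<open>k\<close> by \<open>Ck_on_SucD\<close>.\<close>

lemma Ck_on_mult:
  assumes "open S" "Ck_on k S f" "Ck_on k S g"
  shows "Ck_on k S (\<lambda>x. f x * g x)"
  using assms(2,3)
proof (induction k arbitrary: f g)
  case (Suc k)
  have d: "(f has_derivative frechet_derivative f (at x)) (at x)"
    "(g has_derivative frechet_derivative g (at x)) (at x)" if "x \<in> S" for x
    using Suc.prems assms(1) that
    by (auto simp: differentiable_on_eq_differentiable_at frechet_derivative_works)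
  have "f x * partial i g x + partial i f x * g x = partial i (\<lambda>x. f x * g x) x"
    if "x \<in> S" for i x
    using partial_eq[OF has_derivative_mult[OF d[OF that]], of i] by (simp add: partial_def)
  moreover have "Ck_on k S (\<lambda>x. f x * partial i g x + partial i f x * g x)" for i
    using Suc.prems Ck_on_SucD by (intro Ck_on_add assms(1) Suc.IH) auto
  ultimately have "Ck_on k S (partial i (\<lambda>x. f x * g x))" for i
    using Ck_on_cong[OF assms(1), of "\<lambda>x. f x * partial i g x + partial i f x * g x"] by auto
  then show ?case using Suc.prems
    by (auto simp: differentiable_on_def intro: differentiable_mult)
qed (auto intro: continuous_on_mult)

text \<open>The derivative of 1/f is -f'/f^2, a product of f' and of 1/f itself at one order less.
  The induction hypothesis for the same \<open>f\<close> therefore suffices.\<close>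

lemma Ck_on_inverse:
  assumes "open S" "\<And>x. x \<in> S \<Longrightarrow> f x \<noteq> 0" "Ck_on k S f"
  shows "Ck_on k S (\<lambda>x. inverse (f x))"
  using assms(3)
proof (induction k)
  case 0
  then show ?case using assms(2) by (auto intro: continuous_on_inverse)
next
  case (Suc k)
  have d: "(f has_derivative frechet_derivative f (at x)) (at x)" if "x \<in> S" for x
    using Suc.prems assms(1) that
    by (auto simp: differentiable_on_eq_differentiable_at frechet_derivative_works)
  have inv: "Ck_on k S (\<lambda>x. inverse (f x))"
    using Suc Ck_on_SucD by blast
  have "(-1) * (inverse (f x) * partial i f x * inverse (f x)) = partial i (\<lambda>x. inverse (f x)) x"
    if "x \<in> S" for i x
    using partial_eq[OF Deriv.has_derivative_inverse[OF assms(2)[OF that] d[OF that]], of i]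
    by (simp add: partial_def)
  moreover have "Ck_on k S (\<lambda>x. (-1) * (inverse (f x) * partial i f x * inverse (f x)))" for i
    using Suc.prems by (intro Ck_on_mult Ck_on_const assms(1) inv) auto
  ultimately have "Ck_on k S (partial i (\<lambda>x. inverse (f x)))" for i
    using Ck_on_cong[OF assms(1), of "\<lambda>x. (-1) * (inverse (f x) * partial i f x * inverse (f x))"]
    by auto
  moreover have "(\<lambda>x. inverse (f x)) differentiable_on S"
    unfolding differentiable_on_def
    using Suc.prems assms(2) by (auto simp: differentiable_on_def intro!: differentiable_inverse)
  ultimately show ?case by simp
qed

lemma Cinf_on_cong:
  "open S \<Longrightarrow> (\<And>x. x \<in> S \<Longrightarrow> f x = g x) \<Longrightarrow> Cinf_on S f \<Longrightarrow> Cinf_on S g"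
  unfolding Cinf_on_def using Ck_on_cong by blast

lemma Cinf_on_partial: "Cinf_on S f \<Longrightarrow> Cinf_on S (partial i f)"
  unfolding Cinf_on_def by (metis Ck_on.simps(2))

lemma Cinf_on_differentiable:
  "open S \<Longrightarrow> x \<in> S \<Longrightarrow> Cinf_on S f \<Longrightarrow> f differentiable (at x)"
  unfolding Cinf_on_def by (metis Ck_on.simps(2) differentiable_on_eq_differentiable_at)

lemma Cinf_on_continuous: "Cinf_on S f \<Longrightarrow> continuous_on S f"
  unfolding Cinf_on_def by (metis Ck_on.simps(1))

lemma Cinf_on_const: "Cinf_on S (\<lambda>_. c)"
  by (simp add: Cinf_on_def Ck_on_const)

lemma Cinf_on_mult: "open S \<Longrightarrow> Cinf_on S f \<Longrightarrow> Cinf_on S g \<Longrightarrow> Cinf_on S (\<lambda>x. f x * g x)"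
  by (simp add: Cinf_on_def Ck_on_mult)

lemma Cinf_on_divide:
  "open S \<Longrightarrow> Cinf_on S f \<Longrightarrow> Cinf_on S g \<Longrightarrow> (\<And>x. x \<in> S \<Longrightarrow> g x \<noteq> 0) \<Longrightarrow>
    Cinf_on S (\<lambda>x. f x / g x)"
  by (simp add: Cinf_on_def Ck_on_mult Ck_on_inverse divide_inverse)

lemma Cinf_on_sum:
  "open S \<Longrightarrow> (\<And>i. i \<in> I \<Longrightarrow> Cinf_on S (f i)) \<Longrightarrow> Cinf_on S (\<lambda>x. \<Sum>i\<in>I. f i x)"
  by (induction I rule: infinite_finite_induct) (auto simp: Cinf_on_def Ck_on_const Ck_on_add)

lemma Cinf_on_prod:
  "open S \<Longrightarrow> (\<And>i. i \<in> I \<Longrightarrow> Cinf_on S (f i)) \<Longrightarrow> Cinf_on S (\<lambda>x. \<Prod>i\<in>I. f i x)"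
  by (induction I rule: infinite_finite_induct) (auto simp: Cinf_on_def Ck_on_const Ck_on_mult)

text \<open>By the Leibniz formula the determinant is a polynomial in the entries. It serves both
  the volume density and Cramer's rule for the gradient.\<close>

lemma Cinf_on_det:
  fixes M :: "real^'n::finite \<Rightarrow> real^'k::finite^'k"
  assumes "open S" "\<And>i j. Cinf_on S (\<lambda>x. M x $ i $ j)"
  shows "Cinf_on S (\<lambda>x. det (M x))"
  unfolding det_def by (intro Cinf_on_sum Cinf_on_mult Cinf_on_prod Cinf_on_const assms)

text \<open>A bound with a free parameter \<open>t\<close> does the work of the Cauchy-Schwarz
  inequality: for \<open>t\<close> of the size of \<open>sqrt (c k)\<close> both summands are of
  that size and vanish in the limit.\<close>

lemma tendsto_zero_if_young_bound:
  fixes a c :: "nat \<Rightarrow> real"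
  assumes "\<And>k t. t > 0 \<Longrightarrow> \<bar>a k\<bar> \<le> t * b + c k / t" "\<And>k. c k \<ge> 0" "c \<longlonglongrightarrow> 0"
  shows "a \<longlonglongrightarrow> 0"
proof -
  \<comment> \<open>The second summand keeps \<open>t k\<close> positive where \<open>c k\<close> is
    zero, and itself tends to zero.\<close>
  define t where "t k = sqrt (c k) + inverse (real (Suc k))" for k
  have t0: "t k > 0" for k
    using assms(2)[of k] by (auto simp: t_def intro!: add_nonneg_pos)
  have s0: "(\<lambda>k. sqrt (c k)) \<longlonglongrightarrow> 0"
    using tendsto_real_sqrt[OF assms(3)] by simp
  have "c k / t k \<le> sqrt (c k)" for k
  proof -
    have "c k = sqrt (c k) * sqrt (c k)" using assms(2) by simp
    also have "\<dots> \<le> sqrt (c k) * t k"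
      using assms(2) by (intro mult_left_mono) (auto simp: t_def)
    finally show ?thesis using t0 by (simp add: pos_divide_le_eq)
  qed
  then have "\<bar>a k\<bar> \<le> t k * b + sqrt (c k)" for k
    using assms(1)[OF t0, of k] by (smt (verit))
  moreover have "(\<lambda>k. t k * b + sqrt (c k)) \<longlonglongrightarrow> (0 + 0) * b + 0"
    unfolding t_def by (intro tendsto_intros s0 LIMSEQ_inverse_real_of_nat)
  ultimately show ?thesis
    by (intro Lim_null_comparison[of a "\<lambda>k. t k * b + sqrt (c k)"]) auto
qed

section \<open>Gradients on a Riemannian manifold\<close>

lemma matrix_inv:
  fixes M :: "'a::semiring_1^'n::finite^'m::finite"
  assumes "invertible M"
  shows matrix_inv_right: "M ** matrix_inv M = mat 1"
    and matrix_inv_left: "matrix_inv M ** M = mat 1"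
proof -
  have "\<exists>M'. M ** M' = mat 1 \<and> M' ** M = mat 1" using assms by (simp add: invertible_def)
  from someI_ex[OF this] show "M ** matrix_inv M = mat 1" "matrix_inv M ** M = mat 1"
    by (simp_all add: matrix_inv_def)
qed

section \<open>Charts, the metric in coordinates, and gradients\<close>

locale riemannian_manifold =
  fixes A :: "('m::{second_countable_topology, t2_space}, 'n::finite) chart set"
    and g :: "('m, 'n) metric"
  assumes atlas: "oriented_smooth_atlas A" and metric: "riemannian_metric A g"
begin

lemma chart:
  assumes "c \<in> A"
  shows "open (cdom c)" "open (cmap c ` cdom c)"
    "homeomorphism (cdom c) (cmap c ` cdom c) (cmap c) (cinv c)"
  using assms atlas unfolding oriented_smooth_atlas_def is_chart_def by blast+

lemma chart_inv:
  assumes "c \<in> A"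
  shows "p \<in> cdom c \<Longrightarrow> cinv c (cmap c p) = p"
    "x \<in> cmap c ` cdom c \<Longrightarrow> cinv c x \<in> cdom c"
    "x \<in> cmap c ` cdom c \<Longrightarrow> cmap c (cinv c x) = x"
  using chart(3)[OF assms] by (auto simp: homeomorphism_def)

lemma open_chart_image:
  assumes "c \<in> A" "open U" shows "open (cmap c ` (cdom c \<inter> U))"
proof -
  have "openin (top_of_set (cdom c)) (cdom c \<inter> U)"
    using assms by (simp add: openin_open_Int)
  then have "openin (top_of_set (cmap c ` cdom c)) (cmap c ` (cdom c \<inter> U))"
    using homeomorphism_imp_open_map[OF chart(3)[OF assms(1)]] by blast
  then show ?thesis using chart(2)[OF assms(1)] by (meson openin_open_trans)
qed

lemma charts_cover: "\<exists>c\<in>A. p \<in> cdom c"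
  using atlas unfolding oriented_smooth_atlas_def by blast

lemma chart_at: "chart_at A p \<in> A" "p \<in> cdom (chart_at A p)"
proof -
  have "\<exists>c. c \<in> A \<and> p \<in> cdom c" using charts_cover by blast
  from someI_ex[OF this] show "chart_at A p \<in> A" "p \<in> cdom (chart_at A p)"
    by (auto simp: chart_at_def)
qed

lemma metric_transform:
  assumes "c \<in> A" "c' \<in> A" "p \<in> cdom c" "p \<in> cdom c'"
  shows "g c p = transpose (transition_jac c c' p) ** g c' p ** transition_jac c c' p"
  using assms metric unfolding riemannian_metric_def by blast

lemma metric_pos: "c \<in> A \<Longrightarrow> p \<in> cdom c \<Longrightarrow> v \<noteq> 0 \<Longrightarrow> v \<bullet> (g c p *v v) > 0"
  using metric unfolding riemannian_metric_def by blast

lemma metric_sym: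
  assumes "c \<in> A" "p \<in> cdom c" shows "v \<bullet> (g c p *v w) = w \<bullet> (g c p *v v)"
proof -
  have "transpose (g c p) = g c p"
    using metric assms unfolding riemannian_metric_def by blast
  then have "v v* g c p = g c p *v v" by (metis vector_transpose_matrix)
  then show ?thesis by (metis dot_lmul_matrix inner_commute)
qed

lemma metric_smooth: "c \<in> A \<Longrightarrow> Cinf_on (cmap c ` cdom c) (\<lambda>x. g c (cinv c x) $ i $ j)"
  using metric unfolding riemannian_metric_def by blast

lemma metric_invertible:
  assumes "c \<in> A" "p \<in> cdom c" shows "invertible (g c p)"
proof -
  have "v = 0" if "g c p *v v = 0" for v
    using metric_pos[OF assms, of v] that by force
  then show ?thesis
    using invertible_left_inverse matrix_left_invertible_ker by blast
qed

lemma metric_det: "c \<in> A \<Longrightarrow> p \<in> cdom c \<Longrightarrow> det (g c p) \<noteq> 0"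
  using metric_invertible invertible_det_nz by blast

text \<open>The Jacobians from the two vectors cancel those from the Gram matrix. As
  \<open>rinner\<close> uses a chart chosen separately at each point, this is what permits working
  in one fixed chart when continuity or measurability is at stake.\<close>

lemma rinner_chart:
  assumes "vector_field A V" "vector_field A W" "c \<in> A" "p \<in> cdom c"
  shows "rinner A g V W p = V c p \<bullet> (g c p *v W c p)"
proof -
  let ?c = "chart_at A p" let ?J = "transition_jac ?c c p"
  have tr: "V c p = ?J *v V ?c p" "W c p = ?J *v W ?c p"
    using assms chart_at unfolding vector_field_def by blast+
  have "rinner A g V W p = V ?c p \<bullet> ((transpose ?J ** g c p ** ?J) *v W ?c p)"
    using metric_transform[OF chart_at(1) assms(3) chart_at(2) assms(4)]
    by (simp add: rinner_def Let_def)
  also have "\<dots> = V ?c p \<bullet> (transpose ?J *v (g c p *v W c p))"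
    by (simp add: tr matrix_vector_mul_assoc matrix_mul_assoc)
  also have "\<dots> = V c p \<bullet> (g c p *v W c p)"
    unfolding tr by (metis dot_lmul_matrix vector_transpose_matrix)
  finally show ?thesis .
qed

lemma rinner_commute: "rinner A g V W p = rinner A g W V p"
  using metric_sym[OF chart_at] by (simp add: rinner_def Let_def)

lemma rinner_nonneg: "rinner A g V V p \<ge> 0"
  using metric_pos[OF chart_at, where v="V (chart_at A p) p" and p=p]
  by (cases "V (chart_at A p) p = 0") (auto simp: rinner_def Let_def)

lemma rinner_diff_right:
  "rinner A g V (\<lambda>c p. W c p - Z c p) p = rinner A g V W p - rinner A g V Z p"
  by (simp add: rinner_def Let_def matrix_vector_mult_diff_distrib inner_diff_right)

text \<open>Young's inequality, obtained by expanding the nonnegative quadratic form at tv + w and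
  tv - w.\<close>

lemma rinner_young:
  assumes "t > 0"
  shows "\<bar>rinner A g V W p\<bar> \<le> t * rinner A g V V p + rinner A g W W p / t"
proof -
  let ?c = "chart_at A p"
  define v w M where "v = V ?c p" and "w = W ?c p" and "M = g ?c p"
  have sym: "w \<bullet> (M *v v) = v \<bullet> (M *v w)"
    unfolding M_def by (rule metric_sym[OF chart_at])
  have nn: "x \<bullet> (M *v x) \<ge> 0" for x
    using metric_pos[OF chart_at, where v=x and p=p] unfolding M_def by (cases "x = 0") auto
  have eq: "rinner A g V W p = v \<bullet> (M *v w)" "rinner A g V V p = v \<bullet> (M *v v)"
    "rinner A g W W p = w \<bullet> (M *v w)"
    by (simp_all add: rinner_def Let_def v_def w_def M_def)
  have "0 \<le> (t *\<^sub>R v + s *\<^sub>R w) \<bullet> (M *v (t *\<^sub>R v + s *\<^sub>R w))" for s by (rule nn)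
  then have "0 \<le> t * t * (v \<bullet> (M *v v)) + 2 * s * t * (v \<bullet> (M *v w)) + s * s * (w \<bullet> (M *v w))" for s
    by (simp add: matrix_vector_right_distrib matrix_vector_mult_scaleR inner_add_left
        inner_add_right sym algebra_simps)
  \<comment> \<open>The two signs of \<open>s\<close> bound the mixed term from both sides, hence
    its absolute value.\<close>
  from this[of 1] this[of "-1"]
  have "2 * t * \<bar>v \<bullet> (M *v w)\<bar> \<le> t * t * (v \<bullet> (M *v v)) + w \<bullet> (M *v w)"
    by (auto simp: abs_if)
  \<comment> \<open>A factor 2 is given away so that cancelling \<open>2 * t\<close> leaves exactly
    the claimed bound.\<close>
  also have "\<dots> \<le> 2 * t * (t * (v \<bullet> (M *v v)) + w \<bullet> (M *v w) / t)"
    using assms nn[of v] nn[of w] by (simp add: algebra_simps)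
  finally show ?thesis
    using assms by (simp add: eq)
qed

text \<open>The chain rule: near the point, \<open>u\<close> in the chart \<open>c\<close> is
  \<open>u\<close> in the chart \<open>c'\<close> composed with the transition map.\<close>

lemma coord_partial_transform:
  assumes "c \<in> A" "c' \<in> A" "p \<in> cdom c" "p \<in> cdom c'" "smooth_fun A UNIV u"
  shows "coord_partial c i u p =
    (\<Sum>k\<in>UNIV. transition_jac c c' p $ k $ i * coord_partial c' k u p)"
proof -
  let ?T = "transition c c'" and ?x = "cmap c p" and ?f = "u \<circ> cinv c'"
  let ?S = "cmap c ` (cdom c \<inter> cdom c')"
  have oS: "open ?S" by (simp add: assms chart open_chart_image)
  have xS: "?x \<in> ?S" using assms by blast
  have Tx: "?T ?x = cmap c' p" by (simp add: transition_def chart_inv assms)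
  have "Cinf_on ?S (\<lambda>y. ?T y $ i)" for i
    using atlas assms unfolding oriented_smooth_atlas_def by blast
  then have "(\<lambda>y. ?T y $ i) differentiable (at ?x)" for i
    by (rule Cinf_on_differentiable[OF oS xS])
  \<comment> \<open>The atlas speaks of the components of the transition map; they are assembled
    into one differentiable map here.\<close>
  then have "?T differentiable (at ?x)"
    by (subst differentiable_componentwise_within) (auto simp: Basis_vec_def inner_axis)
  then have dT: "(?T has_derivative frechet_derivative ?T (at ?x)) (at ?x)"
    by (simp add: frechet_derivative_works)
  have "Cinf_on (cmap c' ` cdom c') ?f"
    using assms by (auto simp: smooth_fun_def)
  then have "?f differentiable (at (?T ?x))"
    using Cinf_on_differentiable[OF chart(2)[OF assms(2)]] assms(4) Tx by simp
  then have df: "(?f has_derivative frechet_derivative ?f (at (?T ?x))) (at (?T ?x))"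
    by (simp add: frechet_derivative_works)
  let ?DT = "frechet_derivative ?T (at ?x)" and ?Df = "frechet_derivative ?f (at (?T ?x))"
  have "(?f \<circ> ?T has_derivative ?Df \<circ> ?DT) (at ?x)"
    by (rule diff_chain_at[OF dT df])
  then have "(u \<circ> cinv c has_derivative ?Df \<circ> ?DT) (at ?x)"
    by (rule has_derivative_transform_within_open[OF _ oS xS])
      (auto simp: transition_def chart_inv assms)
  then have "coord_partial c i u p = ?Df (?DT (axis i 1))"
    by (simp add: coord_partial_def partial_eq)
  \<comment> \<open>The image of the \<open>i\<close>-th basis vector is the \<open>i\<close>-th
    column of the Jacobian.\<close>
  also have "?DT (axis i 1) = (\<Sum>k\<in>UNIV. (transition_jac c c' p $ k $ i) *\<^sub>R axis k 1)"
    by (simp add: transition_jac_def jacobian_def matrix_def basis_expansion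
        scalar_mult_eq_scaleR[symmetric])
  also have "?Df \<dots> = (\<Sum>k\<in>UNIV. transition_jac c c' p $ k $ i * ?Df (axis k 1))"
    using has_derivative_linear[OF df] by (simp add: linear_sum linear_cmul)
  finally show ?thesis by (simp add: coord_partial_def partial_def Tx)
qed

lemma metric_mult_grad:
  assumes "c \<in> A" "p \<in> cdom c"
  shows "g c p *v grad g u c p = (\<chi> i. coord_partial c i u p)"
  by (simp add: grad_def matrix_vector_mul_assoc matrix_inv_right metric_invertible assms)

text \<open>The gradient is determined by its image under the metric, the differential. The
  differential transforms with the transposed Jacobian and the metric with the Jacobian on both
  sides; cancelling the transposed Jacobian and then \<open>g c' p\<close> leaves the law for
  vectors.\<close>

lemma vector_field_grad:
  assumes "smooth_fun A UNIV u" shows "vector_field A (grad g u)"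
  unfolding vector_field_def
proof (intro ballI)
  fix c c' p assume c: "c \<in> A" "c' \<in> A" "p \<in> cdom c \<inter> cdom c'"
  let ?J = "transition_jac c c' p"
  let ?d = "\<lambda>c. \<chi> i. coord_partial c i u p"
  have "det ?J > 0"
    using c atlas unfolding oriented_smooth_atlas_def by blast
  then have inv: "invertible (transpose ?J)"
    by (simp add: invertible_det_nz det_transpose)
  have "transpose ?J *v (g c' p *v (?J *v grad g u c p)) = g c p *v grad g u c p"
    using metric_transform[of c c' p] c by (simp add: matrix_vector_mul_assoc matrix_mul_assoc)
  also have "\<dots> = ?d c" using c by (simp add: metric_mult_grad)
  also have "\<dots> = transpose ?J *v ?d c'"
    using coord_partial_transform[OF c(1,2) _ _ assms] c
    by (simp add: vec_eq_iff matrix_vector_mult_def transpose_def)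
  also have "?d c' = g c' p *v grad g u c' p" using c by (simp add: metric_mult_grad)
  finally have "g c' p *v (?J *v grad g u c p) = g c' p *v grad g u c' p"
    using inv by (metis matrix_inv_left matrix_vector_mul_assoc matrix_vector_mul_lid)
  moreover have "invertible (g c' p)" using c metric_invertible by blast
  ultimately show "grad g u c' p = ?J *v grad g u c p"
    by (metis matrix_inv_left matrix_vector_mul_assoc matrix_vector_mul_lid)
qed

text \<open>Cramer's rule writes each component as a quotient of determinants with smooth entries,
  so the inverse matrix never has to be differentiated.\<close>

lemma grad_smooth:
  assumes "smooth_fun A UNIV u" "c \<in> A"
  shows "Cinf_on (cmap c ` cdom c) (\<lambda>x. grad g u c (cinv c x) $ j)"
proof -
  let ?S = "cmap c ` cdom c"
  \<comment> \<open>The Gram matrix with column \<open>j\<close> replaced by the differential of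
    \<open>u\<close>.\<close>
  let ?M = "\<lambda>x. \<chi> i k. if k = j then partial i (u \<circ> cinv c) x else g c (cinv c x) $ i $ k"
  have oS: "open ?S" using chart assms by blast
  have u: "Cinf_on ?S (u \<circ> cinv c)" using assms by (auto simp: smooth_fun_def)
  have "Cinf_on ?S (\<lambda>x. det (?M x) / det (g c (cinv c x)))"
  proof (intro Cinf_on_divide Cinf_on_det oS metric_smooth assms metric_det chart_inv)
    show "Cinf_on ?S (\<lambda>x. ?M x $ i $ k)" for i k
      using Cinf_on_partial[OF u] metric_smooth[OF assms(2)] by (cases "k = j") simp_all
  qed
  moreover have "det (?M x) / det (g c (cinv c x)) = grad g u c (cinv c x) $ j" if "x \<in> ?S" for x
  proof -
    have p: "cinv c x \<in> cdom c" using that chart_inv assms by blast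
    have "grad g u c (cinv c x) = (\<chi> k. det (\<chi> i j. if j = k
        then (\<chi> i. coord_partial c i u (cinv c x)) $ i else g c (cinv c x) $ i $ j)
        / det (g c (cinv c x)))"
      using cramer[OF metric_det[OF assms(2) p]] metric_mult_grad[OF assms(2) p] by blast
    then show ?thesis
      using that by (simp add: coord_partial_def chart_inv[OF assms(2)] cong: if_cong)
  qed
  ultimately show ?thesis by (rule Cinf_on_cong[OF oS, rotated])
qed

text \<open>The complement of the support is open, so in any chart \<open>u\<close> agrees with zero
  on a whole neighbourhood and its derivative vanishes.\<close>

lemma grad_zero_outside_support:
  assumes "c \<in> A" "p \<in> cdom c" "p \<notin> closure {p. u p \<noteq> 0}"
  shows "grad g u c p = 0"
proof -
  let ?U = "- closure {p. u p \<noteq> 0}"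
  let ?S = "cmap c ` (cdom c \<inter> ?U)"
  have oS: "open ?S" using assms open_chart_image by blast
  have xS: "cmap c p \<in> ?S" using assms by blast
  have "((\<lambda>_. 0) has_derivative (\<lambda>_. 0)) (at (cmap c p))" by simp
  then have "(u \<circ> cinv c has_derivative (\<lambda>_. 0)) (at (cmap c p))"
  proof (rule has_derivative_transform_within_open[OF _ oS xS])
    fix x assume "x \<in> ?S"
    then obtain q where "q \<in> cdom c" "q \<in> ?U" "x = cmap c q" by blast
    then show "0 = (u \<circ> cinv c) x"
      using closure_subset[of "{p. u p \<noteq> 0}"] chart_inv(1)[OF assms(1)] by auto
  qed
  then have "coord_partial c i u p = 0" for i
    by (simp add: coord_partial_def partial_eq)
  then show ?thesis by (simp add: grad_def matrix_vector_mult_def vec_eq_iff)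
qed

text \<open>This makes gradients of test functions admissible in the definition of the weak gradient
  in \<open>W12\<close>, where their divergence is the Laplacian.\<close>

lemma test_vector_field_grad:
  assumes "test_fun A \<Omega> u" shows "test_vector_field A \<Omega> (grad g u)"
proof -
  have sm: "smooth_fun A UNIV u" and K: "compact (closure {p. u p \<noteq> 0})"
    "closure {p. u p \<noteq> 0} \<subseteq> \<Omega>" using assms by (auto simp: test_fun_def)
  let ?S = "closure {p. \<exists>c\<in>A. p \<in> cdom c \<and> grad g u c p \<noteq> 0}"
  have sub: "?S \<subseteq> closure {p. u p \<noteq> 0}"
  proof (rule closure_minimal)
    show "{p. \<exists>c\<in>A. p \<in> cdom c \<and> grad g u c p \<noteq> 0} \<subseteq> closure {p. u p \<noteq> 0}"
      using grad_zero_outside_support by blast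
  qed simp
  have "compact (closure {p. u p \<noteq> 0} \<inter> ?S)"
    by (rule compact_Int_closed[OF K(1) closed_closure])
  then have "compact ?S" using sub by (simp only: Int_absorb1)
  moreover have "?S \<subseteq> \<Omega>" using sub K(2) by (rule subset_trans)
  moreover have "\<forall>c\<in>A. \<forall>j. Cinf_on (cmap c ` cdom c) (\<lambda>x. grad g u c (cinv c x) $ j)"
    using grad_smooth[OF sm] by blast
  ultimately show ?thesis
    unfolding test_vector_field_def Let_def using vector_field_grad[OF sm] by blast
qed

section \<open>Continuity checked chart by chart\<close>

lemma continuous_on_UNIV_charts:
  fixes f :: "'m \<Rightarrow> 'b::topological_space"
  assumes "\<And>c. c \<in> A \<Longrightarrow> continuous_on (cdom c) f" shows "continuous_on UNIV f"
proof -
  have "(\<Union>c\<in>A. cdom c) = UNIV" using charts_cover by blast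
  moreover have "continuous_on (\<Union>c\<in>A. cdom c) f"
    using chart assms by (intro continuous_on_open_UN) auto
  ultimately show ?thesis by simp
qed

lemma continuous_on_chart:
  fixes f :: "'m \<Rightarrow> 'b::topological_space"
  assumes "c \<in> A" "continuous_on (cmap c ` cdom c) (\<lambda>x. f (cinv c x))"
  shows "continuous_on (cdom c) f"
proof -
  have "continuous_on (cdom c) ((\<lambda>x. f (cinv c x)) \<circ> cmap c)"
    using chart(3)[OF assms(1)] assms(2) by (intro continuous_on_compose) (auto simp: homeomorphism_def)
  then show ?thesis
    by (rule continuous_on_eq) (simp add: chart_inv assms)
qed

lemma continuous_on_test_fun:
  assumes "test_fun A \<Omega> u" shows "continuous_on UNIV u"
proof (intro continuous_on_UNIV_charts continuous_on_chart)
  fix c assume "c \<in> A"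
  then have "Cinf_on (cmap c ` cdom c) (u \<circ> cinv c)"
    using assms by (auto simp: test_fun_def smooth_fun_def)
  from Cinf_on_continuous[OF this]
  show "continuous_on (cmap c ` cdom c) (\<lambda>x. u (cinv c x))" by (simp add: o_def)
qed

lemma continuous_on_grad:
  assumes "smooth_fun A UNIV u" "c \<in> A"
  shows "continuous_on (cdom c) (grad g u c)"
proof (rule continuous_on_chart[OF assms(2)])
  have "continuous_on (cmap c ` cdom c) (\<lambda>x. \<chi> j. grad g u c (cinv c x) $ j)"
    by (intro continuous_on_vec_lambda Cinf_on_continuous grad_smooth assms)
  then show "continuous_on (cmap c ` cdom c) (\<lambda>x. grad g u c (cinv c x))" by simp
qed

lemma continuous_on_metric:
  assumes "c \<in> A" shows "continuous_on (cdom c) (g c)"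
proof (rule continuous_on_chart[OF assms])
  have "continuous_on (cmap c ` cdom c) (\<lambda>x. \<chi> i j. g c (cinv c x) $ i $ j)"
    by (intro continuous_on_vec_lambda Cinf_on_continuous metric_smooth assms)
  then show "continuous_on (cmap c ` cdom c) (\<lambda>x. g c (cinv c x))" by simp
qed

lemma continuous_on_rinner_grad:
  assumes "smooth_fun A UNIV u" shows "continuous_on UNIV (rinner A g (grad g u) (grad g u))"
proof (intro continuous_on_UNIV_charts)
  fix c assume c: "c \<in> A"
  have vf: "vector_field A (grad g u)" by (rule vector_field_grad[OF assms])
  have "continuous_on (cdom c)
    (\<lambda>p. \<Sum>i\<in>UNIV. grad g u c p $ i * (\<Sum>j\<in>UNIV. g c p $ i $ j * grad g u c p $ j))"
    by (intro continuous_on_sum continuous_on_mult continuous_on_component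
        continuous_on_grad continuous_on_metric assms c)
  then show "continuous_on (cdom c) (rinner A g (grad g u) (grad g u))"
    by (rule continuous_on_eq) (simp add: rinner_chart[OF vf vf c] inner_vec_def matrix_vector_mult_def)
qed

end

section \<open>Square integrable functions and fields\<close>

lemma young_abs:
  fixes a b t :: real
  assumes "t > 0" shows "\<bar>a * b\<bar> \<le> t * a\<^sup>2 + b\<^sup>2 / t"
proof -
  have "2 * (t * \<bar>a * b\<bar>) \<le> (t * a)\<^sup>2 + b\<^sup>2"
    using sum_squares_bound[of "t * \<bar>a\<bar>" "\<bar>b\<bar>"] by (simp add: abs_mult power_mult_distrib)
  moreover have "0 \<le> t * \<bar>a * b\<bar>" using assms by simp
  ultimately have "t * \<bar>a * b\<bar> \<le> (t * a)\<^sup>2 + b\<^sup>2" by linarith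
  also have "\<dots> = t * (t * a\<^sup>2 + b\<^sup>2 / t)"
    using assms by (simp add: field_simps power2_eq_square)
  finally show ?thesis using assms by simp
qed

lemma integrable_mult_L2:
  assumes "f \<in> L2 N" "w \<in> L2 N" shows "integrable N (\<lambda>x. f x * w x)"
proof (rule Bochner_Integration.integrable_bound)
  show "integrable N (\<lambda>x. (f x)\<^sup>2 + (w x)\<^sup>2)" using assms by (simp add: L2_def)
  show "(\<lambda>x. f x * w x) \<in> borel_measurable N"
    using assms by (intro borel_measurable_times) (simp_all add: L2_def)
  show "AE x in N. norm (f x * w x) \<le> norm ((f x)\<^sup>2 + (w x)\<^sup>2)"
    using young_abs[of 1] by (intro AE_I2) simp
qed

lemma L2_diff:
  assumes "f \<in> L2 N" "w \<in> L2 N" shows "(\<lambda>x. f x - w x) \<in> L2 N"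
proof -
  have "integrable N (\<lambda>x. (f x)\<^sup>2 + (w x)\<^sup>2 - 2 * (f x * w x))"
    using assms integrable_mult_L2[OF assms]
    by (intro Bochner_Integration.integrable_diff Bochner_Integration.integrable_add
        integrable_mult_right) (auto simp: L2_def)
  then have "integrable N (\<lambda>x. (f x - w x)\<^sup>2)" by (simp add: power2_diff mult.assoc)
  moreover have "(\<lambda>x. f x - w x) \<in> borel_measurable N"
    using assms by (intro borel_measurable_diff) (simp_all add: L2_def)
  ultimately show ?thesis by (simp add: L2_def)
qed

text \<open>Continuity of the inner product in one argument: integrating \<open>young_abs\<close>
  bounds the pairing of \<open>f\<close> with the error for every \<open>t\<close>, which is the
  input of the limit criterion above.\<close>

lemma tendsto_integral_mult_L2:
  assumes "f \<in> L2 N" "w \<in> L2 N" "\<And>k. \<phi> k \<in> L2 N"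
    and lim: "(\<lambda>k. \<integral>x. (\<phi> k x - w x)\<^sup>2 \<partial>N) \<longlonglongrightarrow> 0"
  shows "(\<lambda>k. \<integral>x. f x * \<phi> k x \<partial>N) \<longlonglongrightarrow> (\<integral>x. f x * w x \<partial>N)"
proof -
  let ?z = "\<lambda>k x. \<phi> k x - w x"
  have z: "?z k \<in> L2 N" for k by (rule L2_diff[OF assms(3,2)])
  have i2: "integrable N (\<lambda>x. (f x)\<^sup>2)" "integrable N (\<lambda>x. (?z k x)\<^sup>2)" for k
    using assms(1) z by (auto simp: L2_def)
  have "\<bar>\<integral>x. f x * ?z k x \<partial>N\<bar> \<le> t * (\<integral>x. (f x)\<^sup>2 \<partial>N) + (\<integral>x. (?z k x)\<^sup>2 \<partial>N) / t"
    if "t > 0" for k t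
  proof -
    have "\<bar>\<integral>x. f x * ?z k x \<partial>N\<bar> \<le> (\<integral>x. \<bar>f x * ?z k x\<bar> \<partial>N)" by (rule integral_abs_bound)
    also have "\<dots> \<le> (\<integral>x. t * (f x)\<^sup>2 + (?z k x)\<^sup>2 / t \<partial>N)"
      using i2 integrable_mult_L2[OF assms(1) z] young_abs[OF that] by (intro integral_mono) simp_all
    also have "\<dots> = t * (\<integral>x. (f x)\<^sup>2 \<partial>N) + (\<integral>x. (?z k x)\<^sup>2 \<partial>N) / t"
      using i2 by simp
    finally show ?thesis .
  qed
  from tendsto_zero_if_young_bound[OF this _ lim]
  have "(\<lambda>k. \<integral>x. f x * ?z k x \<partial>N) \<longlonglongrightarrow> 0" by simp
  moreover have "(\<integral>x. f x * ?z k x \<partial>N) = (\<integral>x. f x * \<phi> k x \<partial>N) - (\<integral>x. f x * w x \<partial>N)" for k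
    using integrable_mult_L2[OF assms(1,3)] integrable_mult_L2[OF assms(1,2)]
    by (simp add: right_diff_distrib)
  ultimately show ?thesis by (simp add: LIM_zero_iff)
qed

context riemannian_manifold
begin

text \<open>A continuous function with compact support is bounded, and bounded measurable functions
  are square integrable for a finite measure.\<close>

lemma test_fun_L2:
  assumes "test_fun A \<Omega> u" "finite_measure \<mu>" "sets \<mu> = sets borel" "open \<Omega>"
  shows "u \<in> L2 (restrict_space \<mu> \<Omega>)"
proof -
  let ?K = "closure {p. u p \<noteq> 0}"
  have cont: "continuous_on UNIV u" by (rule continuous_on_test_fun[OF assms(1)])
  have meas: "u \<in> borel_measurable \<mu>"
    using borel_measurable_continuous_onI[OF cont] by (simp only: measurable_cong_sets[OF assms(3) refl])
  have "compact ?K" using assms(1) by (simp add: test_fun_def)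
  then obtain B where B: "\<And>x. x \<in> ?K \<Longrightarrow> \<bar>u x\<bar> \<le> B"
    using continuous_on_compact_bound[OF _ continuous_on_subset[OF cont subset_UNIV]]
    by (metis real_norm_def)
  \<comment> \<open>\<open>B\<close> bounds \<open>u\<close> on the support only and was obtained
    without a sign; the maximum with 0 covers the remaining points, where \<open>u\<close> is
    zero.\<close>
  have "\<bar>u x\<bar> \<le> max B 0" for x
    using B[of x] closure_subset[of "{p. u p \<noteq> 0}"] by (cases "u x = 0") auto
  then have "(u x)\<^sup>2 \<le> (max B 0)\<^sup>2" for x by (metis abs_ge_zero power2_abs power_mono)
  then have "integrable \<mu> (\<lambda>x. (u x)\<^sup>2)"
    using meas by (intro finite_measure.integrable_const_bound[OF assms(2)]) auto
  moreover have "\<Omega> \<in> sets \<mu>" using assms by simp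
  ultimately have "integrable (restrict_space \<mu> \<Omega>) (\<lambda>x. (u x)\<^sup>2)"
    using integrable_mult_indicator[of \<Omega> \<mu> "\<lambda>x. (u x)\<^sup>2"]
    by (subst integrable_restrict_space) (auto dest: sets.sets_into_space intro!: sets.Int)
  then show ?thesis using meas by (simp add: L2_def measurable_restrict_space1)
qed

end

section \<open>Riemannian volume and square integrable vector fields on the domain\<close>

locale riemannian_domain = riemannian_manifold A g
  for A :: "('m::{second_countable_topology, t2_space}, 'n::finite) chart set"
    and g :: "('m, 'n) metric" +
  fixes \<nu> :: "'m measure" and \<Omega> :: "'m set"
  assumes volume: "riemannian_volume A g \<nu>" and open_\<Omega>: "open \<Omega>"
begin

lemma sets_\<nu>: "sets \<nu> = sets borel"
  using volume by (simp add: riemannian_volume_def)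

lemma space_\<nu>: "space \<nu> = UNIV"
  using sets_eq_imp_space_eq[OF sets_\<nu>] by simp

text \<open>In a chart the volume is an integral of a continuous density, which is bounded on a
  small closed ball of finite Lebesgue measure.\<close>

lemma volume_locally_finite: "\<exists>N. open N \<and> p \<in> N \<and> emeasure \<nu> N < \<infinity>"
proof -
  obtain c where c: "c \<in> A" "p \<in> cdom c" using charts_cover by blast
  let ?S = "cmap c ` cdom c" and ?d = "\<lambda>x. vol_density g c (cinv c x)"
  obtain r where r: "r > 0" "cball (cmap c p) r \<subseteq> ?S"
    using chart(2)[OF c(1)] c(2) open_contains_cball by blast
  let ?C = "cball (cmap c p) r" and ?B = "ball (cmap c p) r"
  have "continuous_on ?S ?d"
    unfolding vol_density_def
    by (intro continuous_on_real_sqrt Cinf_on_continuous Cinf_on_det metric_smooth chart c)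
  from continuous_on_compact_bound[OF compact_cball continuous_on_subset[OF this r(2)]]
  obtain b where b: "\<And>x. x \<in> ?C \<Longrightarrow> \<bar>?d x\<bar> \<le> b"
    by (metis real_norm_def)
  \<comment> \<open>The open ball makes \<open>N\<close> an open neighbourhood, while the closed
    ball around it supplies the bound on the density.\<close>
  define N where "N = cdom c \<inter> cmap c -` ?B"
  have "continuous_on (cdom c) (cmap c)"
    using chart(3)[OF c(1)] by (simp add: homeomorphism_def)
  then have oN: "open N"
    unfolding N_def by (rule continuous_open_preimage) (use chart c in auto)
  have img: "cmap c ` N \<subseteq> ?B" by (auto simp: N_def)
  have "emeasure \<nu> N = (\<integral>\<^sup>+x\<in>cmap c ` N. ennreal (?d x) \<partial>lborel)"
    using volume c(1) oN unfolding riemannian_volume_def by (auto simp: N_def)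
  also have "\<dots> \<le> (\<integral>\<^sup>+x. ennreal b * indicator ?C x \<partial>lborel)"
  proof (rule nn_integral_mono)
    fix x
    show "ennreal (?d x) * indicator (cmap c ` N) x \<le> ennreal b * indicator ?C x"
    proof (cases "x \<in> cmap c ` N")
      case True
      then have "x \<in> ?C" using img by (meson ball_subset_cball subsetD)
      then show ?thesis using True b[of x] by (auto intro!: ennreal_leI)
    qed simp
  qed
  also have "\<dots> = ennreal b * emeasure lborel ?C"
    by (subst nn_integral_cmult_indicator) auto
  also have "\<dots> < \<infinity>"
    using emeasure_compact_finite[OF compact_cball, of "cmap c p" r]
    by (simp add: ennreal_mult_less_top)
  finally show ?thesis using oN c(2) r(1) by (auto simp: N_def)
qed

lemma volume_compact_finite:
  assumes "compact K" shows "emeasure \<nu> K < \<infinity>"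
proof -
  obtain D where D: "D \<subseteq> {N. open N \<and> emeasure \<nu> N < \<infinity>}" "finite D" "K \<subseteq> \<Union>D"
  proof (rule compactE[OF assms])
    show "K \<subseteq> \<Union>{N. open N \<and> emeasure \<nu> N < \<infinity>}" using volume_locally_finite by blast
  qed auto
  have "emeasure \<nu> K \<le> emeasure \<nu> (\<Union>D)"
    using D by (intro emeasure_mono) (auto simp: sets_\<nu> intro!: borel_open)
  also have "\<dots> \<le> (\<Sum>N\<in>D. emeasure \<nu> N)"
    using D emeasure_subadditive_finite[of D "\<lambda>N. N" \<nu>] by (auto simp: sets_\<nu> intro!: borel_open)
  also have "\<dots> < \<infinity>" using D by (auto simp: ennreal_sum_less_top)
  finally show ?thesis .
qed

text \<open>The conditions that \<open>W12\<close> puts on a gradient, without the link to a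
  function. Weak gradients, gradients of test functions and their differences can thus be treated
  alike.\<close>

definition L2_field :: "('m, 'n) vfield \<Rightarrow> bool" where
  "L2_field V \<longleftrightarrow> vector_field A V
     \<and> (\<forall>c\<in>A. V c \<in> borel_measurable (restrict_space \<nu> (\<Omega> \<inter> cdom c)))
     \<and> integrable (restrict_space \<nu> \<Omega>) (rinner A g V V)"

lemma measurable_continuous_on_chart:
  assumes "c \<in> A" "continuous_on (cdom c) f"
  shows "f \<in> borel_measurable (restrict_space \<nu> (\<Omega> \<inter> cdom c))"
proof -
  have "f \<in> borel_measurable (restrict_space borel (\<Omega> \<inter> cdom c))"
    by (intro borel_measurable_continuous_on_restrict continuous_on_subset[OF assms(2)]) auto
  then show ?thesis
    by (simp only: measurable_cong_sets[OF sets_restrict_space_cong[OF sets_\<nu>] refl])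
qed

text \<open>The chart chosen by \<open>chart_at\<close> need not depend measurably on the point.
  Countably many chart domains cover the manifold by the Lindelof property, and on each of them the
  coordinate formula is measurable.\<close>

lemma borel_measurable_rinner:
  assumes "vector_field A V" "vector_field A W"
    and V: "\<And>c. c \<in> A \<Longrightarrow> V c \<in> borel_measurable (restrict_space \<nu> (\<Omega> \<inter> cdom c))"
    and W: "\<And>c. c \<in> A \<Longrightarrow> W c \<in> borel_measurable (restrict_space \<nu> (\<Omega> \<inter> cdom c))"
  shows "rinner A g V W \<in> borel_measurable (restrict_space \<nu> \<Omega>)"
proof -
  obtain C where C: "C \<subseteq> cdom ` A" "countable C" "\<Union>C = \<Union>(cdom ` A)"
    using Lindelof[of "cdom ` A"] chart(1) by blast
  show ?thesis
  proof (rule measurable_piecewise_restrict[OF C(2)])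
    show "space (restrict_space \<nu> \<Omega>) \<subseteq> \<Union>C" using charts_cover C(3) by auto
    fix S assume "S \<in> C"
    then obtain c where c: "c \<in> A" "S = cdom c" using C by blast
    show "S \<inter> space (restrict_space \<nu> \<Omega>) \<in> sets (restrict_space \<nu> \<Omega>)"
      using c chart(1) open_\<Omega>
      by (subst sets_restrict_space_iff) (auto simp: space_restrict_space space_\<nu> sets_\<nu> intro!: borel_open)
    let ?R = "restrict_space \<nu> (\<Omega> \<inter> cdom c)"
    have nth: "(\<lambda>p. X p $ i) \<in> borel_measurable ?R" if "X \<in> borel_measurable ?R" for X :: "'m \<Rightarrow> real^'n" and i
      by (rule measurable_compose[OF that])
        (intro borel_measurable_continuous_onI continuous_on_component continuous_on_id)
    have "(\<lambda>p. g c p $ i $ j) \<in> borel_measurable ?R" for i j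
      by (intro measurable_continuous_on_chart continuous_on_component continuous_on_metric c)
    then have "(\<lambda>p. \<Sum>i\<in>UNIV. V c p $ i * (\<Sum>j\<in>UNIV. g c p $ i $ j * W c p $ j)) \<in> borel_measurable ?R"
      using nth[OF V[OF c(1)]] nth[OF W[OF c(1)]] by measurable
    also have "?this \<longleftrightarrow> rinner A g V W \<in> borel_measurable ?R"
      by (rule measurable_cong)
        (simp add: space_restrict_space rinner_chart[OF assms(1,2) c(1)] inner_vec_def matrix_vector_mult_def)
    finally show "rinner A g V W \<in> borel_measurable (restrict_space (restrict_space \<nu> \<Omega>) S)"
      unfolding c(2) by (simp only: measurable_cong_sets[OF sets_restrict_restrict_space refl])
  qed
qed

lemma integrable_rinner:
  assumes "L2_field V" "L2_field W"
  shows "integrable (restrict_space \<nu> \<Omega>) (rinner A g V W)"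
proof (rule Bochner_Integration.integrable_bound)
  show "integrable (restrict_space \<nu> \<Omega>) (\<lambda>p. rinner A g V V p + rinner A g W W p)"
    using assms by (simp add: L2_field_def)
  show "rinner A g V W \<in> borel_measurable (restrict_space \<nu> \<Omega>)"
    using assms by (intro borel_measurable_rinner) (auto simp: L2_field_def)
  show "AE p in restrict_space \<nu> \<Omega>. norm (rinner A g V W p) \<le> norm (rinner A g V V p + rinner A g W W p)"
    using rinner_young[of 1 V W] rinner_nonneg by (auto intro!: AE_I2)
qed

lemma L2_field_diff:
  assumes "L2_field V" "L2_field W" shows "L2_field (\<lambda>c p. V c p - W c p)"
proof -
  have "rinner A g (\<lambda>c p. V c p - W c p) (\<lambda>c p. V c p - W c p) =
      (\<lambda>p. rinner A g V V p - rinner A g V W p - (rinner A g V W p - rinner A g W W p))"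
    using rinner_commute[of "\<lambda>c p. V c p - W c p"] rinner_commute[of W V]
    by (simp add: rinner_diff_right fun_eq_iff)
  moreover have "integrable (restrict_space \<nu> \<Omega>) \<dots>"
    by (intro Bochner_Integration.integrable_diff integrable_rinner assms)
  moreover have "vector_field A (\<lambda>c p. V c p - W c p)"
    unfolding vector_field_def matrix_vector_mult_diff_distrib
    using assms unfolding L2_field_def vector_field_def by metis
  moreover have "(\<lambda>p. V c p - W c p) \<in> borel_measurable (restrict_space \<nu> (\<Omega> \<inter> cdom c))"
    if "c \<in> A" for c
    using assms that unfolding L2_field_def by (intro borel_measurable_diff) blast+
  ultimately show ?thesis by (simp add: L2_field_def)
qed

lemma L2_field_W12: "W12 A g \<nu> \<Omega> u U \<Longrightarrow> L2_field U"
  by (simp add: W12_def L2_field_def)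

text \<open>The squared length of the gradient is continuous and vanishes off a compact set, which
  has finite volume.\<close>

lemma L2_field_grad:
  assumes "test_fun A \<Omega> u" shows "L2_field (grad g u)"
proof -
  let ?K = "closure {p. u p \<noteq> 0}" and ?f = "rinner A g (grad g u) (grad g u)"
  have sm: "smooth_fun A UNIV u" and K: "compact ?K" "?K \<subseteq> \<Omega>"
    using assms by (auto simp: test_fun_def)
  have cont: "continuous_on UNIV ?f" by (rule continuous_on_rinner_grad[OF sm])
  have meas: "?f \<in> borel_measurable \<nu>"
    using borel_measurable_continuous_onI[OF cont] by (simp only: measurable_cong_sets[OF sets_\<nu> refl])
  from continuous_on_compact_bound[OF K(1) continuous_on_subset[OF cont subset_UNIV]]
  obtain B where B: "\<And>x. x \<in> ?K \<Longrightarrow> \<bar>?f x\<bar> \<le> B"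
    by (metis real_norm_def)
  have "?f x = 0" if "x \<notin> ?K" for x
    using grad_zero_outside_support[OF chart_at that] by (simp add: rinner_def)
  then have "integrable \<nu> ?f"
    using B volume_compact_finite[OF K(1)] meas
    by (intro integrableI_bounded_set[where A = ?K and B = B]) (auto simp: sets_\<nu>)
  moreover have "\<Omega> \<in> sets \<nu>" using open_\<Omega> by (simp add: sets_\<nu>)
  ultimately have "integrable (restrict_space \<nu> \<Omega>) ?f"
    using integrable_mult_indicator[of \<Omega> \<nu> ?f]
    by (subst integrable_restrict_space) (auto simp: space_\<nu>)
  moreover have "grad g u c \<in> borel_measurable (restrict_space \<nu> (\<Omega> \<inter> cdom c))" if "c \<in> A" for c
    by (rule measurable_continuous_on_chart[OF that continuous_on_grad[OF sm that]])
  ultimately show ?thesis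
    using vector_field_grad[OF sm] unfolding L2_field_def by blast
qed

lemma dirichlet_form_commute: "dirichlet_form A g \<nu> \<Omega> V W = dirichlet_form A g \<nu> \<Omega> W V"
  using rinner_commute[of V W] by (simp add: dirichlet_form_def)

text \<open>The analogue for fields of \<open>tendsto_integral_mult_L2\<close>: Young's inequality
  is integrated and the limit criterion applied to the energy of the error.\<close>

lemma tendsto_dirichlet_form:
  assumes "L2_field U" "L2_field V" "\<And>k. test_fun A \<Omega> (\<phi> k)" "W12_tendsto A g \<nu> \<Omega> \<phi> v V"
  shows "(\<lambda>k. dirichlet_form A g \<nu> \<Omega> U (grad g (\<phi> k))) \<longlonglongrightarrow> dirichlet_form A g \<nu> \<Omega> U V"
proof -
  let ?R = "restrict_space \<nu> \<Omega>" and ?D = "dirichlet_form A g \<nu> \<Omega>"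
  let ?Z = "\<lambda>k c p. grad g (\<phi> k) c p - V c p"
  have gr: "L2_field (grad g (\<phi> k))" for k by (rule L2_field_grad[OF assms(3)])
  have Z: "L2_field (?Z k)" for k by (rule L2_field_diff[OF gr assms(2)])
  have nn: "?D (?Z k) (?Z k) \<ge> 0" for k
    unfolding dirichlet_form_def by (rule integral_nonneg_AE) (simp add: rinner_nonneg)
  have lim: "(\<lambda>k. ?D (?Z k) (?Z k)) \<longlonglongrightarrow> 0"
  \<comment> \<open>The energy lies between zero and the Sobolev square, whose other summand is
    nonnegative.\<close>
  proof (rule real_tendsto_sandwich[OF _ _ tendsto_const])
    show "(\<lambda>k. sobolev_sq A g \<nu> \<Omega> (\<lambda>x. \<phi> k x - v x) (?Z k)) \<longlonglongrightarrow> 0"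
      using assms(4) by (simp add: W12_tendsto_def)
  qed (use nn in \<open>auto simp: sobolev_sq_def\<close>)
  have "\<bar>?D U (?Z k)\<bar> \<le> t * ?D U U + ?D (?Z k) (?Z k) / t" if "t > 0" for k t
  proof -
    have "\<bar>?D U (?Z k)\<bar> \<le> (\<integral>x. \<bar>rinner A g U (?Z k) x\<bar> \<partial>?R)"
      unfolding dirichlet_form_def by (rule integral_abs_bound)
    also have "\<dots> \<le> (\<integral>x. t * rinner A g U U x + rinner A g (?Z k) (?Z k) x / t \<partial>?R)"
      using rinner_young[OF that] integrable_rinner assms(1) Z
      by (intro integral_mono) auto
    also have "\<dots> = t * ?D U U + ?D (?Z k) (?Z k) / t"
      using integrable_rinner assms(1) Z by (simp add: dirichlet_form_def)
    finally show ?thesis .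
  qed
  from tendsto_zero_if_young_bound[OF this nn lim]
  have "(\<lambda>k. ?D U (?Z k)) \<longlonglongrightarrow> 0" .
  moreover have "?D U (?Z k) = ?D U (grad g (\<phi> k)) - ?D U V" for k
    using integrable_rinner assms(1,2) gr by (simp add: dirichlet_form_def rinner_diff_right)
  ultimately show ?thesis by (simp add: LIM_zero_iff)
qed

text \<open>Green's formula in weak form: \<open>grad g \<phi>\<close> is inserted into the
  definition of the weak gradient, and the minus sign there cancels that of the Poisson
  equation.\<close>

lemma poisson_solution_test_fun:
  assumes "poisson_solution A g \<nu> \<Omega> \<mu> f u U" "test_fun A \<Omega> \<phi>"
  shows "dirichlet_form A g \<nu> \<Omega> U (grad g \<phi>) = (\<integral>x. f x * \<phi> x \<partial>restrict_space \<mu> \<Omega>)"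
  using assms test_vector_field_grad[OF assms(2)]
  by (simp add: poisson_solution_def W012_def W12_def dirichlet_form_def laplacian_def mult.commute)

text \<open>A single sequence witnesses \<open>iota\<close> and converges both in the Sobolev norm
  and in the \<open>L2\<close> space of \<mu>. The two sides agree along it, and each converges to
  its counterpart for the limit.\<close>

lemma poisson_solution_iota:
  assumes "finite_measure \<mu>" "sets \<mu> = sets borel" "f \<in> L2 (restrict_space \<mu> \<Omega>)"
    and sol: "poisson_solution A g \<nu> \<Omega> \<mu> f u U" and "iota A g \<nu> \<Omega> \<mu> v V w"
  shows "dirichlet_form A g \<nu> \<Omega> U V = (\<integral>x. f x * w x \<partial>restrict_space \<mu> \<Omega>)"
proof -
  obtain \<phi> where test: "\<And>k. test_fun A \<Omega> (\<phi> k)" and lim: "W12_tendsto A g \<nu> \<Omega> \<phi> v V"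
      "(\<lambda>k. \<integral>x. (\<phi> k x - w x)\<^sup>2 \<partial>restrict_space \<mu> \<Omega>) \<longlonglongrightarrow> 0"
    and w: "w \<in> L2 (restrict_space \<mu> \<Omega>)" and V: "W12 A g \<nu> \<Omega> v V"
    using assms(5) by (auto simp: iota_def W012_def)
  have U: "W12 A g \<nu> \<Omega> u U" using sol by (simp add: poisson_solution_def W012_def)
  have "(\<lambda>k. dirichlet_form A g \<nu> \<Omega> U (grad g (\<phi> k))) \<longlonglongrightarrow> dirichlet_form A g \<nu> \<Omega> U V"
    by (rule tendsto_dirichlet_form[OF L2_field_W12[OF U] L2_field_W12[OF V] test lim(1)])
  moreover have "(\<lambda>k. dirichlet_form A g \<nu> \<Omega> U (grad g (\<phi> k)))
      \<longlonglongrightarrow> (\<integral>x. f x * w x \<partial>restrict_space \<mu> \<Omega>)"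
    using tendsto_integral_mult_L2[OF assms(3) w test_fun_L2[OF test assms(1,2) open_\<Omega>] lim(2)]
    by (simp add: poisson_solution_test_fun[OF sol test])
  ultimately show ?thesis by (rule LIMSEQ_unique)
qed

text \<open>For an element of the kernel of \<open>iota\<close> the right-hand side of the pairing
  is an integral of zero, which is the orthogonality required.\<close>

lemma poisson_solution_form_dom:
  assumes "finite_measure \<mu>" "sets \<mu> = sets borel" "f \<in> L2 (restrict_space \<mu> \<Omega>)"
    and sol: "poisson_solution A g \<nu> \<Omega> \<mu> f u U"
  shows "form_dom A g \<nu> \<Omega> \<mu> u U"
proof -
  have "dirichlet_form A g \<nu> \<Omega> U Z = 0" if "iota A g \<nu> \<Omega> \<mu> z Z (\<lambda>_. 0)" for z Z
    using poisson_solution_iota[OF assms that] by simp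
  then show ?thesis using sol unfolding form_dom_def poisson_solution_def by blast
qed

end

section \<open>Inversion of the Krein--Feller operator\<close>

theorem theorem5p9:
  fixes A :: "('m::{second_countable_topology, t2_space}, 'n::finite) chart set"
    and g :: "('m, 'n) metric"
    and \<nu> \<mu> :: "'m measure"
    and \<Omega> :: "'m set"
    and G :: "'m \<Rightarrow> 'm \<Rightarrow> real"
    and h :: "('m \<Rightarrow> real) \<Rightarrow> 'm \<Rightarrow> real"
  assumes "CARD('n) \<ge> 2"
    and "oriented_smooth_atlas A" and "riemannian_metric A g" and "rcomplete A g"
    and "riemannian_volume A g \<nu>"
    and "open \<Omega>" and "connected \<Omega>" and "rbounded A g \<Omega>" and "smooth_boundary A \<Omega>"
    and "dirichlet_green A g \<nu> \<Omega> G"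
    and "finite_measure \<mu>" and "sets \<mu> = sets borel"
    and "msupp \<mu> \<subseteq> closure \<Omega>" and "emeasure \<mu> \<Omega> > 0"
    and "lower_Linf_dim A g \<mu> > ereal (real CARD('n) - 2)"
    and "lower_Linf_dim A g \<nu> > ereal (real CARD('n) - 2)"
    and "harmonic_operator A g \<nu> \<Omega> \<mu> G h"
  shows "(\<forall>f\<in>L2 (restrict_space \<mu> \<Omega>).
            (\<lambda>x. green_op \<Omega> \<mu> G f x + h f x, f) \<in> neg_krein_feller A g \<nu> \<Omega> \<mu>)
       \<and> (\<lambda>f x. green_op \<Omega> \<mu> G f x + h f x) ` L2 (restrict_space \<mu> \<Omega>)
            \<subseteq> Domain (neg_krein_feller A g \<nu> \<Omega> \<mu>)
       \<and> {(f, u). f \<in> L2 (restrict_space \<mu> \<Omega>)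
                  \<and> (AE x in restrict_space \<mu> \<Omega>. u x = green_op \<Omega> \<mu> G f x + h f x)}
            = (neg_krein_feller A g \<nu> \<Omega> \<mu>)\<inverse>"
proof -
  interpret riemannian_domain A g \<nu> \<Omega>
    using assms by unfold_locales
  let ?L = "L2 (restrict_space \<mu> \<Omega>)" and ?D = "dirichlet_form A g \<nu> \<Omega>"
  let ?KF = "neg_krein_feller A g \<nu> \<Omega> \<mu>" and ?T = "\<lambda>f x. green_op \<Omega> \<mu> G f x + h f x"
  note pairing = poisson_solution_iota[OF assms(11,12)]
  note dom = poisson_solution_form_dom[OF assms(11,12)]
  \<comment> \<open>Adding the Green operator to \<open>h f\<close> cancels its subtraction, so
    \<open>?T f\<close> represents the Poisson solution almost everywhere.\<close>
  have solution: "\<exists>u U w. poisson_solution A g \<nu> \<Omega> \<mu> f u U \<and> iota A g \<nu> \<Omega> \<mu> u U w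
      \<and> (AE x in restrict_space \<mu> \<Omega>. ?T f x = w x)" if f: "f \<in> ?L" for f
  proof -
    obtain u U w where *: "poisson_solution A g \<nu> \<Omega> \<mu> f u U" "iota A g \<nu> \<Omega> \<mu> u U w"
        "AE x in restrict_space \<mu> \<Omega>. h f x = w x - green_op \<Omega> \<mu> G f x"
      using assms(17) f unfolding harmonic_operator_def by blast
    from *(3) have "AE x in restrict_space \<mu> \<Omega>. ?T f x = w x" by eventually_elim simp
    with * show ?thesis by blast
  qed
  have forward: "(u', f) \<in> ?KF"
    if f: "f \<in> ?L" and u': "AE x in restrict_space \<mu> \<Omega>. u' x = ?T f x" for f u'
  proof -
    obtain u U w where s: "poisson_solution A g \<nu> \<Omega> \<mu> f u U" "iota A g \<nu> \<Omega> \<mu> u U w"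
        "AE x in restrict_space \<mu> \<Omega>. ?T f x = w x"
      using solution[OF f] by blast
    from u' s(3) have "AE x in restrict_space \<mu> \<Omega>. u' x = w x" by eventually_elim simp
    then show ?thesis
      unfolding neg_krein_feller_def using f s(2) dom[OF f s(1)] pairing[OF f s(1)] by blast
  qed
  have backward: "AE x in restrict_space \<mu> \<Omega>. u' x = ?T f x" if KF: "(u', f) \<in> ?KF" for f u'
  proof -
    obtain u\<^sub>0 U' w' where f: "f \<in> ?L" and w': "iota A g \<nu> \<Omega> \<mu> u\<^sub>0 U' w'"
        "AE x in restrict_space \<mu> \<Omega>. u' x = w' x"
      and weak: "\<And>v\<^sub>0 V v. form_dom A g \<nu> \<Omega> \<mu> v\<^sub>0 V \<Longrightarrow> iota A g \<nu> \<Omega> \<mu> v\<^sub>0 V v \<Longrightarrow>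
        ?D U' V = (\<integral>x. f x * v x \<partial>restrict_space \<mu> \<Omega>)"
      using KF unfolding neg_krein_feller_def by blast
    obtain u U w where s: "poisson_solution A g \<nu> \<Omega> \<mu> f u U" "iota A g \<nu> \<Omega> \<mu> u U w"
        "AE x in restrict_space \<mu> \<Omega>. ?T f x = w x"
      using solution[OF f] by blast
    \<comment> \<open>The difference to be shown null serves as right-hand side of a second Poisson
      problem, solved by \<open>v\<close> below.\<close>
    let ?d = "\<lambda>x. w x - w' x"
    have wL: "w \<in> ?L" "w' \<in> ?L" using s(2) w'(1) by (simp_all add: iota_def)
    have d: "?d \<in> ?L" by (rule L2_diff[OF wL])
    obtain v V z where t: "poisson_solution A g \<nu> \<Omega> \<mu> ?d v V" "iota A g \<nu> \<Omega> \<mu> v V z"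
      using solution[OF d] by blast
    have "(\<integral>x. ?d x * w x \<partial>restrict_space \<mu> \<Omega>) = ?D U V"
      using pairing[OF d t(1) s(2)] dirichlet_form_commute by simp
    \<comment> \<open>Both energies equal the pairing of \<open>f\<close> with \<open>z\<close>. The
      weak equation for \<open>U'\<close> may be tested with \<open>V\<close> because a Poisson
      solution lies in the form domain.\<close>
    also have "\<dots> = ?D U' V"
      using pairing[OF f s(1) t(2)] weak[OF dom[OF d t(1)] t(2)] by simp
    also have "\<dots> = (\<integral>x. ?d x * w' x \<partial>restrict_space \<mu> \<Omega>)"
      using pairing[OF d t(1) w'(1)] dirichlet_form_commute by simp
    finally have "(\<integral>x. ?d x * w x - ?d x * w' x \<partial>restrict_space \<mu> \<Omega>) = 0"
      using integrable_mult_L2[OF d wL(1)] integrable_mult_L2[OF d wL(2)] by simp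
    then have "(\<integral>x. (?d x)\<^sup>2 \<partial>restrict_space \<mu> \<Omega>) = 0"
      by (simp add: power2_eq_square right_diff_distrib)
    moreover have "integrable (restrict_space \<mu> \<Omega>) (\<lambda>x. (?d x)\<^sup>2)"
      using d by (simp add: L2_def)
    ultimately have "AE x in restrict_space \<mu> \<Omega>. (?d x)\<^sup>2 = 0"
      by (subst (asm) integral_nonneg_eq_0_iff_AE) auto
    with w'(2) s(3) show ?thesis by eventually_elim simp
  qed
  have inL: "f \<in> ?L" if "(u', f) \<in> ?KF" for u' f
    using that unfolding neg_krein_feller_def by blast
  have solves: "(?T f, f) \<in> ?KF" if "f \<in> ?L" for f
    by (rule forward[OF that]) simp
  have conv: "(f, u') \<in> ?KF\<inverse> \<longleftrightarrow> f \<in> ?L \<and> (AE x in restrict_space \<mu> \<Omega>. u' x = ?T f x)" for f u'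
    unfolding converse_iff using forward[of f u'] backward[of u' f] inL[of u' f] by blast
  have "{(f, u'). f \<in> ?L \<and> (AE x in restrict_space \<mu> \<Omega>. u' x = ?T f x)} = ?KF\<inverse>"
  proof (rule set_eqI)
    fix z show "z \<in> {(f, u'). f \<in> ?L \<and> (AE x in restrict_space \<mu> \<Omega>. u' x = ?T f x)} \<longleftrightarrow> z \<in> ?KF\<inverse>"
      by (cases z) (simp only: mem_Collect_eq prod.case conv)
  qed
  with solves show ?thesis by blast
qed

end
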